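(* Let $n\ge1$, let $\Gamma$ be a regular subdivision of the $n$-dimensional ball $\mathbb B^n$ and let $\Lambda$ be a regular subdivision of $\Gamma$ such that both subdivisions have the interior of the ball as a face. Then the alternating sum of $\mathbf{cd}$-indexes of semisuspensions is equal to zero: $$\sum_{F\in\Gamma}(-1)^{\rho(F,\hat1)}\cdot\Psi(\mathrm{Semi}(\Lambda|_F,n))=0,$$ where the sum is over all faces $F$ of $\Gamma$, including the empty face $\hat0$ and the face $\hat1$ which is the interior of the ball.
   Context: Regular subdivision: $\Gamma$ is a finite regular CW decomposition of the closed ball $\mathbb B^n$ whose only $n$-cell is the interior of the ball; $\Lambda$ is a finite regular CW decomposition of $\mathbb B^n$ refining $\Gamma$ (every closed cell of $\Gamma$ is a union of closed cells of $\Lambda$), whose only $n$-cell is also the interior of the ball. The empty face (dimension $-1$) is included among the faces. $\rho(F)=\dim F+1$ and $\rho(F,\hat1)=n+1-\rho(F)$. For a face $F\ne\hat1$ of $\Gamma$, $\Lambda|_F$ is the subdivision of $F$ induced by $\Lambda$, i.e. the complex of all faces of $\Lambda$ contained in the closed cell $\overline F$ (including the empty face); for $F=\emptyset$ it is the complex $\{\emptyset\}$. A quasi-graded poset $(P,\rho,\bar\zeta)$ consists of a finite poset $P$, a function $\rho:P\to\mathbb N$ with $x<y\Rightarrow\rho(x)<\rho(y)$, and a function $\bar\zeta$ in the incidence algebra of $P$ with $\bar\zeta(x,x)=1$. Write $\rho(x,y)=\rho(y)-\rho(x)$. If $P$ has minimal element $\hat0$ and maximal element $\hat1$, $\hat0<\hat1$,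 its $\mathbf{ab}$-index is the polynomial in non-commuting variables $\mathbf a,\mathbf b$ $$\Psi(P)=\sum\bar\zeta(x_0,x_1)\cdots\bar\zeta(x_{k-1},x_k)\cdot(\mathbf a-\mathbf b)^{\rho(x_0,x_1)-1}\,\mathbf b\,(\mathbf a-\mathbf b)^{\rho(x_1,x_2)-1}\,\mathbf b\cdots\mathbf b\,(\mathbf a-\mathbf b)^{\rho(x_{k-1},x_k)-1},$$ summed over all chains $\hat0=x_0<x_1<\cdots<x_k=\hat1$. For the posets here it is a polynomial in $\mathbf c=\mathbf a+\mathbf b$, $\mathbf d=\mathbf a\mathbf b+\mathbf b\mathbf a$ and is then called the $\mathbf{cd}$-index. Semisuspension. For a finite regular cell complex $\Delta$ with $\dim\Delta<n$, $\mathrm{Semi}(\Delta,n)$ is obtained by embedding $\Delta$ in the boundary of an $n$-ball, with the cells of $\Delta$, $\partial\mathbb B^n\setminus\Delta$ and the interior of the ball as strata. $\Psi(\mathrm{Semi}(\Delta,n))$ is the $\mathbf{ab}$-index of its face poset, which is the following quasi-graded poset: the elements are the faces of $\Delta$ (with $\hat0=\emptyset$) and two further elements $*$ and $\hat1$; $\rho(x)=\dim x+1$ for faces, $\rho( * )=n$, $\rho(\hat1)=n+1$; faces are ordered by inclusion of closures, every other element is $<\hat1$, and $x<*$ for every face $x$ with $\rho(x)<n$ (faces of dimension $n-1$ are incomparable to $*$); $$\bar\zeta(x,* )=1+(-1)^{n-\rho(x)}\,\widetilde\chi(\mathrm{link}_\Delta(x)),\qquad \widetilde\chi(\mathrm{link}_\Delta(x))=\sum_{y\in\Delta,\,y\ge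 x}(-1)^{\dim y-\dim x-1},$$ and $\bar\zeta=1$ on all other intervals. For $F=\hat1$, $\mathrm{Semi}(\Lambda|_{\hat1},n)$ denotes the subdivision $\Lambda$ of the ball itself, and $\Psi(\mathrm{Semi}(\Lambda|_{\hat1},n))$ is the $\mathbf{ab}$-index of the face poset of $\Lambda$ (including $\emptyset$ and the interior of the ball) with $\rho=\dim+1$ and $\bar\zeta\equiv1$. *)

theory Defs
  imports "HOL-Homology.Homology" "HOL-Library.Poly_Mapping"
begin

section \<open>Polynomials in the non-commuting variables a and b\<close>

datatype letter = LA | LB

datatype word = Word (letters: "letter list")

instantiation word :: monoid_add
begin

definition zero_word :: word where "0 = Word []"

definition plus_word :: "word \<Rightarrow> word \<Rightarrow> word"
  where "u + v = Word (letters u @ letters v)"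

instance
  by standard (simp_all add: zero_word_def plus_word_def)

end

text \<open>Words form a monoid under concatenation (written additively, as
  \<^theory>\<open>HOL-Library.Poly_Mapping\<close> expects), so the convolution product of \<open>word \<Rightarrow>\<^sub>0 int\<close> makes it
  the free associative ring on two generators.\<close>

type_synonym ab_poly = "word \<Rightarrow>\<^sub>0 int"

definition va :: ab_poly where "va = Poly_Mapping.single (Word [LA]) 1"
definition vb :: ab_poly where "vb = Poly_Mapping.single (Word [LB]) 1"


section \<open>Quasi-graded posets and the ab-index\<close>

record 'p ranked_poset =
  elems :: "'p set"
  ple :: "'p \<Rightarrow> 'p \<Rightarrow> bool"
  prank :: "'p \<Rightarrow> nat"
  pzeta :: "'p \<Rightarrow> 'p \<Rightarrow> int"

definition plt :: "'p ranked_poset \<Rightarrow> 'p \<Rightarrow> 'p \<Rightarrow> bool"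
  where "plt P x y \<longleftrightarrow> ple P x y \<and> x \<noteq> y"

definition quasi_graded :: "'p ranked_poset \<Rightarrow> bool"
  where "quasi_graded P \<longleftrightarrow>
    finite (elems P) \<and>
    (\<forall>x\<in>elems P. ple P x x) \<and>
    (\<forall>x\<in>elems P. \<forall>y\<in>elems P. ple P x y \<and> ple P y x \<longrightarrow> x = y) \<and>
    (\<forall>x\<in>elems P. \<forall>y\<in>elems P. \<forall>z\<in>elems P. ple P x y \<and> ple P y z \<longrightarrow> ple P x z) \<and>
    (\<forall>x\<in>elems P. \<forall>y\<in>elems P. plt P x y \<longrightarrow> prank P x < prank P y) \<and>
    (\<forall>x\<in>elems P. pzeta P x x = 1)"

text \<open>The chains \<open>x\<^sub>0 < x\<^sub>1 < \<dots> < x\<^sub>k\<close> with \<open>k \<ge> 1\<close> from the least to the greatest element,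
  as lists \<open>[x\<^sub>0, \<dots>, x\<^sub>k]\<close>.\<close>

definition maxmin_chains :: "'p ranked_poset \<Rightarrow> 'p list set"
  where "maxmin_chains P = {xs. set xs \<subseteq> elems P \<and> length xs \<ge> 2 \<and> sorted_wrt (plt P) xs \<and>
    (\<forall>y\<in>elems P. ple P (hd xs) y) \<and> (\<forall>y\<in>elems P. ple P y (last xs))}"

lemma finite_maxmin_chains:
  assumes "finite (elems P)"
  shows "finite (maxmin_chains P)"
proof -
  have "distinct xs" if "sorted_wrt (plt P) xs" for xs
    using that by (induction xs) (auto simp: plt_def)
  then have "maxmin_chains P \<subseteq> {xs. set xs \<subseteq> elems P \<and> distinct xs}"
    by (auto simp: maxmin_chains_def)
  then show ?thesis
    using finite_subset_distinct[OF assms] finite_subset by blast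
qed

fun chain_weight :: "'p ranked_poset \<Rightarrow> 'p list \<Rightarrow> ab_poly"
  where
    "chain_weight P [x, y] = of_int (pzeta P x y) * (va - vb) ^ (prank P y - prank P x - 1)"
  | "chain_weight P (x # y # z # zs) =
       of_int (pzeta P x y) * (va - vb) ^ (prank P y - prank P x - 1) * vb * chain_weight P (y # z # zs)"
  | "chain_weight P _ = 0"

definition ab_index :: "'p ranked_poset \<Rightarrow> ab_poly"
  where "ab_index P = (\<Sum>xs\<in>maxmin_chains P. chain_weight P xs)"


section \<open>Finite regular CW decompositions\<close>

definition closed_ball :: "nat \<Rightarrow> (nat \<Rightarrow> real) topology"
  where "closed_ball k = subtopology (Euclidean_space k) {x. (\<Sum>i<k. x i ^ 2) \<le> 1}"

definition open_ball :: "nat \<Rightarrow> (nat \<Rightarrow> real) set"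
  where "open_ball k = {x \<in> topspace (Euclidean_space k). (\<Sum>i<k. x i ^ 2) < 1}"

definition regular_cell :: "'a topology \<Rightarrow> nat \<Rightarrow> 'a set \<Rightarrow> bool"
  where "regular_cell X k e \<longleftrightarrow>
    (\<exists>f. homeomorphic_map (closed_ball k) (subtopology X (X closure_of e)) f \<and>
         f ` open_ball k = e)"

text \<open>Well defined by invariance of dimension, see \<open>cell_dim_eq\<close>.\<close>

definition cell_dim :: "'a topology \<Rightarrow> 'a set \<Rightarrow> nat"
  where "cell_dim X e = (THE k. regular_cell X k e)"

lemma open_ball_subset: "open_ball k \<subseteq> topspace (closed_ball k)"
  by (auto simp: open_ball_def closed_ball_def)

lemma zero_in_open_ball: "(\<lambda>_. 0) \<in> open_ball k"
  by (simp add: open_ball_def topspace_Euclidean_space)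

lemma openin_open_ball: "openin (Euclidean_space k) (open_ball k)"
proof -
  have "continuous_map (Euclidean_space k) euclideanreal (\<lambda>x. \<Sum>i<k. x i ^ 2)"
    unfolding Euclidean_space_def
    by (intro continuous_map_from_subtopology continuous_intros) auto
  from openin_continuous_map_preimage[OF this, of "{..<1}"] show ?thesis
    by (simp add: open_ball_def)
qed

lemma regular_cell_nonempty: "regular_cell X k e \<Longrightarrow> e \<noteq> {}"
  using zero_in_open_ball by (fastforce simp: regular_cell_def)

lemma regular_cell_subset: "regular_cell X k e \<Longrightarrow> e \<subseteq> topspace X"
proof -
  assume "regular_cell X k e"
  then obtain f where f: "homeomorphic_map (closed_ball k) (subtopology X (X closure_of e)) f"
    and e: "f ` open_ball k = e" by (auto simp: regular_cell_def)
  have "f ` topspace (closed_ball k) \<subseteq> topspace X"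
    using homeomorphic_imp_surjective_map[OF f] by auto
  then show ?thesis using e open_ball_subset[of k] by blast
qed

lemma regular_cell_homeomorphic:
  assumes "regular_cell X k e"
  shows "subtopology (Euclidean_space k) (open_ball k) homeomorphic_space subtopology X e"
proof -
  obtain f where f: "homeomorphic_map (closed_ball k) (subtopology X (X closure_of e)) f"
    and e: "f ` open_ball k = e" using assms by (auto simp: regular_cell_def)
  have "homeomorphic_map (subtopology (closed_ball k) (open_ball k))
          (subtopology (subtopology X (X closure_of e)) e) f"
  proof (rule homeomorphic_map_subtopologies[OF f])
    have "inj_on f (topspace (closed_ball k))" using homeomorphic_imp_injective_map[OF f] .
    moreover have "f ` topspace (closed_ball k) = topspace (subtopology X (X closure_of e))"
      using homeomorphic_imp_surjective_map[OF f] .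
    ultimately show "f ` (topspace (closed_ball k) \<inter> open_ball k) =
        topspace (subtopology X (X closure_of e)) \<inter> e"
      using e open_ball_subset[of k] by blast
  qed
  moreover have "subtopology (closed_ball k) (open_ball k) =
      subtopology (Euclidean_space k) (open_ball k)"
  proof -
    have "{x. (\<Sum>i<k. (x i)\<^sup>2) \<le> (1::real)} \<inter> open_ball k = open_ball k"
      by (auto simp: open_ball_def)
    then show ?thesis by (simp add: closed_ball_def subtopology_subtopology)
  qed
  moreover have "subtopology (subtopology X (X closure_of e)) e = subtopology X e"
    using closure_of_subset[OF regular_cell_subset[OF assms]]
    by (simp add: subtopology_subtopology inf.absorb2)
  ultimately show ?thesis
    using homeomorphic_map_imp_homeomorphic_space by metis
qed

lemma open_ball_not_flat:
  assumes "m < k" "openin (Euclidean_space k) U" "U \<noteq> {}"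
  shows "\<not> U \<subseteq> topspace (Euclidean_space m)"
proof
  assume sub: "U \<subseteq> topspace (Euclidean_space m)"
  obtain p where p: "p \<in> U" using assms(3) by blast
  let ?g = "\<lambda>t::real. \<lambda>i. if i < k then (if i = m then t else p i) else 0"
  have cont: "continuous_map euclideanreal (Euclidean_space k) ?g"
    unfolding continuous_map_componentwise_Euclidean_space by simp
  have pk: "p \<in> topspace (Euclidean_space k)" using p assms(2) openin_subset by blast
  have pm: "p m = 0" using p sub by (auto simp: topspace_Euclidean_space)
  have g0: "?g 0 = p" using pk pm by (auto simp: topspace_Euclidean_space fun_eq_iff)
  have "openin euclideanreal {t \<in> topspace euclideanreal. ?g t \<in> U}"
    by (rule openin_continuous_map_preimage[OF cont assms(2)])
  then have "open {t. ?g t \<in> U}" by simp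
  moreover have "{t. ?g t \<in> U} = {0}"
  proof -
    have "t = 0" if "?g t \<in> U" for t
    proof -
      have "?g t m = 0" using that sub by (fastforce simp only: topspace_Euclidean_space)
      then show ?thesis using assms(1) by simp
    qed
    then show ?thesis using g0 p by auto
  qed
  ultimately show False using not_open_singleton by metis
qed

lemma open_balls_homeomorphic_le:
  assumes "subtopology (Euclidean_space k) (open_ball k) homeomorphic_space
           subtopology (Euclidean_space m) (open_ball m)"
  shows "k \<le> m"
proof (rule ccontr)
  assume "\<not> k \<le> m"
  then have mk: "m < k" by simp
  obtain f where f: "homeomorphic_map (subtopology (Euclidean_space k) (open_ball k))
           (subtopology (Euclidean_space m) (open_ball m)) f"
    using assms homeomorphic_space by blast
  have sub: "open_ball j \<subseteq> topspace (Euclidean_space j)" for j by (auto simp: open_ball_def)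
  have inj: "inj_on f (open_ball k)"
    using homeomorphic_imp_injective_map[OF f] sub[of k] by (simp add: inf.absorb2)
  have im: "f ` open_ball k = open_ball m"
    using homeomorphic_imp_surjective_map[OF f] sub by (simp add: inf.absorb2)
  have eq: "Euclidean_space m = subtopology (Euclidean_space k) (topspace (Euclidean_space m))"
  proof -
    have "{x. \<forall>i\<ge>k. x i = 0} \<inter> {x. \<forall>i\<ge>m. x i = 0} = {x::nat \<Rightarrow> real. \<forall>i\<ge>m. x i = 0}"
      using mk by auto
    then show ?thesis
      by (simp add: topspace_Euclidean_space) (simp add: Euclidean_space_def subtopology_subtopology)
  qed
  have "continuous_map (subtopology (Euclidean_space k) (open_ball k)) (Euclidean_space m) f"
    using homeomorphic_imp_continuous_map[OF f] continuous_map_in_subtopology by blast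
  then have "continuous_map (subtopology (Euclidean_space k) (open_ball k)) (Euclidean_space k) f"
    using eq continuous_map_in_subtopology by metis
  from invariance_of_domain_Euclidean_space[OF openin_open_ball this inj]
  have "openin (Euclidean_space k) (open_ball m)" by (simp add: im)
  from open_ball_not_flat[OF mk this] show False
    using sub zero_in_open_ball[of m] by blast
qed

lemma cell_dim_eq:
  assumes "regular_cell X k e"
  shows "cell_dim X e = k"
  unfolding cell_dim_def
proof (rule the_equality[where P = "\<lambda>k. regular_cell X k e", OF assms])
  fix m assume m: "regular_cell X m e"
  note hk = regular_cell_homeomorphic[OF assms]
  note hm = regular_cell_homeomorphic[OF m]
  have "subtopology (Euclidean_space k) (open_ball k) homeomorphic_space
        subtopology (Euclidean_space m) (open_ball m)"
    using homeomorphic_space_trans[OF hk homeomorphic_space_sym[THEN iffD1, OF hm]] .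
  then show "m = k"
    using open_balls_homeomorphic_le homeomorphic_space_sym order_antisym by blast
qed

text \<open>The members of \<open>K\<close> are the nonempty open cells. As \<open>K\<close> is finite, closure finiteness and the
  weak topology are automatic.\<close>

definition regular_CW :: "'a topology \<Rightarrow> 'a set set \<Rightarrow> bool"
  where "regular_CW X K \<longleftrightarrow>
    Hausdorff_space X \<and> finite K \<and> disjoint K \<and> \<Union>K = topspace X \<and>
    (\<forall>e\<in>K. (\<exists>k. regular_cell X k e) \<and>
       X closure_of e - e \<subseteq> \<Union>{e' \<in> K. cell_dim X e' < cell_dim X e})"

definition cw_refines :: "'a topology \<Rightarrow> 'a set set \<Rightarrow> 'a set set \<Rightarrow> bool"
  where "cw_refines X L K \<longleftrightarrow> (\<forall>F\<in>K. \<exists>M\<subseteq>L. X closure_of F = (\<Union>e\<in>M. X closure_of e))"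


section \<open>Faces\<close>

text \<open>The empty face is represented by the empty set, which is never a cell.\<close>

definition faces :: "'a set set \<Rightarrow> 'a set set"
  where "faces K = insert {} K"

definition face_le :: "'a topology \<Rightarrow> 'a set \<Rightarrow> 'a set \<Rightarrow> bool"
  where "face_le X x y \<longleftrightarrow> X closure_of x \<subseteq> X closure_of y"

text \<open>The rank \<open>\<rho>\<close> is dimension plus one, with dimension \<open>-1\<close> for the empty face.\<close>

definition face_rank :: "'a topology \<Rightarrow> 'a set \<Rightarrow> nat"
  where "face_rank X x = (if x = {} then 0 else cell_dim X x + 1)"

definition face_poset :: "'a topology \<Rightarrow> 'a set set \<Rightarrow> 'a set ranked_poset"
  where "face_poset X K =
    \<lparr>elems = faces K, ple = face_le X, prank = face_rank X, pzeta = (\<lambda>_ _. 1)\<rparr>"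

lemma face_rank_less:
  assumes K: "regular_CW X K" and x: "x \<in> faces K" and y: "y \<in> faces K"
    and le: "face_le X x y" and ne: "x \<noteq> y"
  shows "face_rank X x < face_rank X y"
proof -
  have cell: "\<exists>k. regular_cell X k e" if "e \<in> K" for e
    using that K by (auto simp: regular_CW_def)
  have sub: "e \<subseteq> X closure_of e" if e: "e \<in> faces K" for e
  proof (cases "e = {}")
    case False
    then obtain k where "regular_cell X k e" using e cell by (auto simp: faces_def)
    from closure_of_subset[OF regular_cell_subset[OF this]] show ?thesis .
  qed simp
  have "y \<noteq> {}"
  proof
    assume "y = {}"
    then have "x \<subseteq> {}" using le sub[OF x] by (simp add: face_le_def)
    then show False using \<open>y = {}\<close> ne by simp
  qed
  then have yK: "y \<in> K" using y by (simp add: faces_def)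
  show ?thesis
  proof (cases "x = {}")
    case True
    then show ?thesis using \<open>y \<noteq> {}\<close> by (simp add: face_rank_def)
  next
    case False
    then have xK: "x \<in> K" using x by (simp add: faces_def)
    have disj: "disjoint K" using K by (simp add: regular_CW_def)
    obtain p where p: "p \<in> x" using False by blast
    have "p \<notin> y" using disjointD[OF disj xK yK ne] p by blast
    then have "p \<in> X closure_of y - y" using sub[OF x] le p by (auto simp: face_le_def)
    then have "p \<in> \<Union>{e' \<in> K. cell_dim X e' < cell_dim X y}"
      using K yK unfolding regular_CW_def by blast
    then obtain e' where e': "e' \<in> K" "cell_dim X e' < cell_dim X y" "p \<in> e'" by blast
    have "e' = x" using disjointD[OF disj e'(1) xK] e'(3) p by blast
    then show ?thesis using e' False \<open>y \<noteq> {}\<close> by (simp add: face_rank_def)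
  qed
qed

lemma face_le_antisym:
  assumes "regular_CW X K" "x \<in> faces K" "y \<in> faces K" "face_le X x y" "face_le X y x"
  shows "x = y"
  using face_rank_less[OF assms(1-4)] face_rank_less[OF assms(1,3,2,5)] by fastforce

lemma quasi_graded_face_poset:
  assumes "regular_CW X K"
  shows "quasi_graded (face_poset X K)"
proof -
  have "finite (faces K)" using assms by (simp add: faces_def regular_CW_def)
  then show ?thesis
    using face_rank_less[OF assms] face_le_antisym[OF assms]
    by (auto simp: quasi_graded_def face_poset_def plt_def) (auto simp: face_le_def)
qed

text \<open>The faces of \<open>L\<close>, including the empty one, that are contained in the closed cell of \<open>F\<close>.\<close>

definition restrict_faces :: "'a topology \<Rightarrow> 'a set set \<Rightarrow> 'a set \<Rightarrow> 'a set set"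
  where "restrict_faces X L F = {x \<in> faces L. x \<subseteq> X closure_of F}"


section \<open>Semisuspension\<close>

text \<open>In this section \<open>D\<close> is the set of all faces of a complex, including the empty face.
  The exponent \<open>dim y - dim x - 1\<close> is \<open>-1\<close> for \<open>y = x\<close>; below it is shifted by 2.\<close>

definition link_chi :: "'a topology \<Rightarrow> 'a set set \<Rightarrow> 'a set \<Rightarrow> int"
  where "link_chi X D x =
    (\<Sum>y | y \<in> D \<and> face_le X x y. (-1) ^ (face_rank X y - face_rank X x + 1))"

datatype 'f semi_face = Face 'f | Star | Top

fun semi_le :: "'a topology \<Rightarrow> nat \<Rightarrow> 'a set semi_face \<Rightarrow> 'a set semi_face \<Rightarrow> bool"
  where
    "semi_le X n (Face x) (Face y) \<longleftrightarrow> face_le X x y"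
  | "semi_le X n (Face x) Star \<longleftrightarrow> face_rank X x < n"
  | "semi_le X n Star (Face y) \<longleftrightarrow> False"
  | "semi_le X n Star Star \<longleftrightarrow> True"
  | "semi_le X n Top (Face y) \<longleftrightarrow> False"
  | "semi_le X n Top Star \<longleftrightarrow> False"
  | "semi_le X n _ Top \<longleftrightarrow> True"

fun semi_rank :: "'a topology \<Rightarrow> nat \<Rightarrow> 'a set semi_face \<Rightarrow> nat"
  where
    "semi_rank X n (Face x) = face_rank X x"
  | "semi_rank X n Star = n"
  | "semi_rank X n Top = n + 1"

fun semi_zeta ::
  "'a topology \<Rightarrow> 'a set set \<Rightarrow> nat \<Rightarrow> 'a set semi_face \<Rightarrow> 'a set semi_face \<Rightarrow> int"
  where
    "semi_zeta X D n (Face x) Star = 1 + (-1) ^ (n - face_rank X x) * link_chi X D x"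
  | "semi_zeta X D n _ _ = 1"

definition Semi :: "'a topology \<Rightarrow> 'a set set \<Rightarrow> nat \<Rightarrow> 'a set semi_face ranked_poset"
  where "Semi X D n =
    \<lparr>elems = Face ` D \<union> {Star, Top}, ple = semi_le X n, prank = semi_rank X n,
     pzeta = semi_zeta X D n\<rparr>"

lemma quasi_graded_Semi:
  assumes K: "regular_CW X K" and D: "D \<subseteq> faces K"
    and dim: "\<And>x. x \<in> D \<Longrightarrow> face_rank X x \<le> n"
  shows "quasi_graded (Semi X D n)"
proof -
  have fin: "finite D"
    using K D by (auto simp: faces_def regular_CW_def intro: finite_subset)
  have less: "face_rank X x < face_rank X y" if "x \<in> D" "y \<in> D" "face_le X x y" "x \<noteq> y" for x y
    using face_rank_less[OF K] D that by blast
  have anti: "x = y" if "x \<in> D" "y \<in> D" "face_le X x y" "face_le X y x" for x y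
    using face_le_antisym[OF K] D that by blast
  have trans: "face_le X x z" if "face_le X x y" "face_le X y z" for x y z
    using that by (auto simp: face_le_def)
  have refl: "face_le X x x" for x by (simp add: face_le_def)
  have lt_n: "face_rank X x < n" if "x \<in> D" "y \<in> D" "face_le X x y" "face_rank X y < n" for x y
    using less[of x y] that by (cases "x = y") auto
  show ?thesis
    using fin dim less anti trans refl lt_n
    unfolding quasi_graded_def Semi_def plt_def
    by (auto simp: le_imp_less_Suc dest: trans)
qed

text \<open>The \<open>ab\<close>-index of \<open>Semi(\<Lambda>|\<^sub>F, n)\<close> for a subdivision \<open>\<Lambda>\<close> of the \<open>n\<close>-ball, where \<open>F\<close> is a
  face of the coarser subdivision; the open ball plays the role of the maximal face, for which
  \<open>Semi\<close> is \<open>\<Lambda>\<close> itself.\<close>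

definition semi_index :: "nat \<Rightarrow> (nat \<Rightarrow> real) set set \<Rightarrow> (nat \<Rightarrow> real) set \<Rightarrow> ab_poly"
  where "semi_index n L F =
    (if F = open_ball n then ab_index (face_poset (closed_ball n) L)
     else ab_index (Semi (closed_ball n) (restrict_faces (closed_ball n) L F) n))"

end

theory Submission
  imports Defs
begin

text \<open>
  Group the chains of all the semisuspensions by their part \<open>\<emptyset> = x\<^sub>0 < \<dots> < x\<^sub>j = x\<close> inside
  \<open>\<Lambda>\<close> minus the top cell. Such a chain occurs for exactly the \<open>F\<close> with \<open>x \<subseteq> cl F\<close>, so its coefficient
  vanishes as soon as, for every such \<open>x\<close>, both \<open>\<Sum>(-1)^\<rho>(F)\<close> over the \<open>F \<in> \<Gamma>\<close> with \<open>x \<subseteq> cl F\<close> and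
  \<open>\<Sum>(-1)^\<rho>(y)\<close> over the \<open>y \<in> \<Lambda>\<close> with \<open>x \<le> y\<close> are zero; the second sum enters through the
  links in \<open>\<zeta>(x, *)\<close> after exchanging the order of summation.

  Both identities compare Euler characteristics. For a point \<open>p\<close> of the boundary sphere, the ball and
  the ball without \<open>p\<close> are contractible. On the other hand, attaching a closed \<open>k\<close>-cell changes the
  Euler characteristic of the complement of \<open>p\<close> by \<open>(-1)^k\<close> if the closed cell misses \<open>p\<close>, and not at
  all otherwise, because a closed ball without a point \<open>p\<close> retracts radially from \<open>p\<close> onto its
  boundary without \<open>p\<close>. Subtracting, \<open>\<Sum>(-1)^dim e\<close> over the cells with \<open>p \<in> cl e\<close> is zero. The condition
  \<open>p \<in> cl e\<close> becomes \<open>x \<subseteq> cl e\<close> for \<open>p \<in> x\<close> since closed cells are unions of open cells, which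
  follows from invariance of domain.
\<close>

section \<open>Rank of abelian groups\<close>

text \<open>Links are never analysed as topological spaces. The only geometric facts about the ball
  are that it stays contractible after losing a boundary point and that dimension is invariant.
  Closed cells through \<open>p\<close> are no longer balls once \<open>p\<close> is removed, so a
  cell count for CW complexes does not apply to the punctured ball and is redone one attached cell
  at a time. The Euler characteristic is an alternating sum of ranks of integral singular homology.
  To run it through exact sequences, kernels and images need ranks too, and torsion must be ignored.
  For a fixed chain ending in \<open>x\<close>, the signs of the faces F other than the open ball
  with x in cl F sum to -1. This cancels the same chain in \<Lambda> itself, which belongs to the
  open ball with sign +1. For the chains through \<open>Star\<close>, the summand 1 of the zeta
  value again gives -1, while the link terms sum to (-1)^(n - \<rho> x) and carry that same factor,
  which gives +1. The restriction to \<open>x\<close> different from the open ball is essential: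
  puncturing the ball at an interior point destroys contractibility.\<close>

definition zcomb :: "('a, 'b) monoid_scheme \<Rightarrow> nat \<Rightarrow> (nat \<Rightarrow> 'a) \<Rightarrow> (nat \<Rightarrow> int) \<Rightarrow> 'a"
  where "zcomb G k x c = finprod G (\<lambda>i. x i [^]\<^bsub>G\<^esub> c i) {..<k}"

definition zindep :: "('a, 'b) monoid_scheme \<Rightarrow> nat \<Rightarrow> (nat \<Rightarrow> 'a) \<Rightarrow> bool"
  where "zindep G k x \<longleftrightarrow> (\<forall>c. zcomb G k x c = \<one>\<^bsub>G\<^esub> \<longrightarrow> (\<forall>i<k. c i = 0))"

text \<open>The family \<open>x\<close> is a basis of \<open>S\<close> up to torsion. All combinations are formed in the ambient group
  \<open>G\<close>, so that kernels and images need not be turned into groups of their own.\<close>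

definition has_rank :: "('a, 'b) monoid_scheme \<Rightarrow> 'a set \<Rightarrow> nat \<Rightarrow> bool"
  where "has_rank G S r \<longleftrightarrow> (\<exists>x. x \<in> {..<r} \<rightarrow> S \<and> zindep G r x \<and>
    (\<forall>g\<in>S. \<exists>m c. m \<noteq> (0::int) \<and> g [^]\<^bsub>G\<^esub> m = zcomb G r x c))"

section \<open>Integer combinations in an abelian group\<close>

context comm_group
begin

lemma zcomb_0 [simp]: "zcomb G 0 x c = \<one>"
  by (simp add: zcomb_def)

lemma zcomb_Suc:
  assumes "x \<in> {..<Suc k} \<rightarrow> carrier G"
  shows "zcomb G (Suc k) x c = zcomb G k x c \<otimes> x k [^] c k"
proof -
  have "(\<lambda>i. x i [^] c i) \<in> {..<k} \<rightarrow> carrier G" "x k \<in> carrier G"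
    using assms by auto
  then show ?thesis
    by (simp add: zcomb_def lessThan_Suc m_comm)
qed

lemma zcomb_closed [simp]:
  assumes "x \<in> {..<k} \<rightarrow> carrier G"
  shows "zcomb G k x c \<in> carrier G"
  unfolding zcomb_def using assms by (intro finprod_closed) auto

lemma zcomb_cong:
  assumes "\<And>i. i < k \<Longrightarrow> x i = y i" "\<And>i. i < k \<Longrightarrow> c i = d i" "y \<in> {..<k} \<rightarrow> carrier G"
  shows "zcomb G k x c = zcomb G k y d"
  unfolding zcomb_def by (rule finprod_cong') (use assms in auto)

lemma zcomb_add:
  assumes "x \<in> {..<k} \<rightarrow> carrier G"
  shows "zcomb G k x (\<lambda>i. c i + d i) = zcomb G k x c \<otimes> zcomb G k x d"
proof -
  have "zcomb G k x (\<lambda>i. c i + d i) = finprod G (\<lambda>i. x i [^] c i \<otimes> x i [^] d i) {..<k}"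
    unfolding zcomb_def by (rule finprod_cong') (use assms in \<open>auto simp: int_pow_mult Pi_iff\<close>)
  also have "\<dots> = zcomb G k x c \<otimes> zcomb G k x d"
    unfolding zcomb_def by (rule finprod_multf) (use assms in auto)
  finally show ?thesis .
qed

lemma zcomb_zero [simp]: "zcomb G k x (\<lambda>i. 0) = \<one>"
  by (simp add: zcomb_def)

lemma zcomb_mult:
  assumes "x \<in> {..<k} \<rightarrow> carrier G"
  shows "zcomb G k x (\<lambda>i. c i * m) = zcomb G k x c [^] m"
  using assms
proof (induction k)
  case (Suc k)
  then have "x \<in> {..<k} \<rightarrow> carrier G" "x k \<in> carrier G" by auto
  then show ?case
    using Suc by (simp add: zcomb_Suc int_pow_pow int_pow_distrib)
qed simp

lemma zcomb_uminus:
  assumes "x \<in> {..<k} \<rightarrow> carrier G"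
  shows "zcomb G k x (\<lambda>i. - c i) = inv (zcomb G k x c)"
  using zcomb_mult[OF assms, of c "-1"] assms by (simp add: int_pow_neg)

lemma zcomb_append:
  assumes "x \<in> {..<k} \<rightarrow> carrier G" "y \<in> {..<l} \<rightarrow> carrier G"
  shows "zcomb G (k + l) (\<lambda>i. if i < k then x i else y (i - k)) c =
    zcomb G k x c \<otimes> zcomb G l y (\<lambda>i. c (k + i))"
  using assms(2)
proof (induction l)
  case 0
  then show ?case
    using assms(1) by (auto intro!: zcomb_cong)
next
  case (Suc l)
  let ?z = "\<lambda>i. if i < k then x i else y (i - k)"
  have y: "y \<in> {..<l} \<rightarrow> carrier G" "y l \<in> carrier G" using Suc.prems by auto
  have "?z \<in> {..<Suc (k + l)} \<rightarrow> carrier G"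
  proof
    fix i assume "i \<in> {..<Suc (k + l)}"
    then show "?z i \<in> carrier G"
      using assms(1) Suc.prems by (cases "i < k") (auto simp: Pi_iff)
  qed
  then have "zcomb G (k + Suc l) ?z c = zcomb G (k + l) ?z c \<otimes> y l [^] c (k + l)"
    by (simp add: zcomb_Suc)
  also have "\<dots> = zcomb G k x c \<otimes> zcomb G (Suc l) y (\<lambda>i. c (k + i))"
    using y Suc.IH Suc.prems assms(1) by (simp add: zcomb_Suc m_assoc)
  finally show ?case .
qed

lemma zcomb_zcomb:
  assumes "x \<in> {..<r} \<rightarrow> carrier G"
  shows "zcomb G s (\<lambda>i. zcomb G r x (C i)) d = zcomb G r x (\<lambda>j. \<Sum>i<s. C i j * d i)"
proof (induction s)
  case (Suc s)
  then show ?case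
    using assms by (simp add: zcomb_Suc zcomb_add zcomb_mult)
qed simp

end

lemma zcomb_hom:
  assumes "comm_group G" "comm_group H" "f \<in> hom G H" "x \<in> {..<k} \<rightarrow> carrier G"
  shows "f (zcomb G k x c) = zcomb H k (\<lambda>i. f (x i)) c"
proof -
  interpret G: comm_group G by fact
  interpret H: comm_group H by fact
  interpret group_hom G H f using assms(3) by unfold_locales
  show ?thesis
    using assms(4)
  proof (induction k)
    case (Suc k)
    then have "x \<in> {..<k} \<rightarrow> carrier G" "x k \<in> carrier G" "(\<lambda>i. f (x i)) \<in> {..<Suc k} \<rightarrow> carrier H"
      by (auto simp: Pi_iff)
    then show ?case
      using Suc by (simp add: G.zcomb_Suc H.zcomb_Suc hom_int_pow)
  qed simp
qed

text \<open>Fraction-free Gaussian elimination, by induction on the number of equations: either the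
  last equation is void, or an unknown with a nonzero coefficient in it is eliminated. Multiplying
  through by the pivot keeps everything integral.\<close>

lemma nontrivial_integer_solution:
  fixes C :: "nat \<Rightarrow> nat \<Rightarrow> int"
  assumes "r < s"
  shows "\<exists>d. (\<exists>i<s. d i \<noteq> 0) \<and> (\<forall>j<r. (\<Sum>i<s. C i j * d i) = 0)"
  using assms
proof (induction r arbitrary: s C)
  case 0
  then show ?case by (intro exI[of _ "\<lambda>_. 1"]) auto
next
  case (Suc r)
  then obtain t where s: "s = Suc t" and rt: "r < t" by (cases s) auto
  show ?case
  proof (cases "\<forall>i<s. C i r = 0")
    case True
    from Suc.IH[of s C] Suc.prems obtain d where
      "\<exists>i<s. d i \<noteq> 0" "\<forall>j<r. (\<Sum>i<s. C i j * d i) = 0" by auto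
    then show ?thesis
      using True by (intro exI[of _ d]) (auto simp: less_Suc_eq)
  next
    case False
    then obtain p where p: "p < s" "C p r \<noteq> 0" by auto
    define e where "e i = (if i < p then i else Suc i)" for i
    have bij: "bij_betw e {..<t} ({..<s} - {p})"
      unfolding bij_betw_def
    proof
      show "inj_on e {..<t}" by (auto simp: inj_on_def e_def split: if_splits)
      have "i \<in> e ` {..<t}" if "i < s" "i \<noteq> p" for i
      proof (cases "i < p")
        case True
        then show ?thesis using that p s by (intro image_eqI[of _ _ i]) (auto simp: e_def)
      next
        case False
        then show ?thesis using that p s by (intro image_eqI[of _ _ "i - 1"]) (auto simp: e_def)
      qed
      then have "{..<s} - {p} \<subseteq> e ` {..<t}" by blast
      moreover have "e ` {..<t} \<subseteq> {..<s} - {p}"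
        using p s by (auto simp: e_def)
      ultimately show "e ` {..<t} = {..<s} - {p}" by blast
    qed
    from Suc.IH[OF rt, of "\<lambda>i j. C (e i) j * C p r - C (e i) r * C p j"]
    obtain d where d: "\<exists>i<t. d i \<noteq> 0"
      "\<forall>j<r. (\<Sum>i<t. (C (e i) j * C p r - C (e i) r * C p j) * d i) = 0" by auto
    define f where "f = the_inv_into {..<t} e"
    have fe: "f (e i) = i" if "i < t" for i
      using bij that by (auto simp: f_def bij_betw_def the_inv_into_f_f)
    \<comment> \<open>Back substitution: the eliminated unknown \<open>p\<close> takes the value
      forced by equation \<open>r\<close>, and the others are scaled by the pivot
      \<open>C p r\<close> in place of a division.\<close>
    define d' where "d' i = (if i = p then - (\<Sum>i<t. C (e i) r * d i) else C p r * d (f i))" for i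
    have sum: "(\<Sum>i<s. C i j * d' i) = (\<Sum>i<t. (C (e i) j * C p r - C (e i) r * C p j) * d i)" for j
    proof -
      have ne: "e i \<noteq> p" for i by (auto simp: e_def)
      have "(\<Sum>i<s. C i j * d' i) = C p j * d' p + (\<Sum>i\<in>{..<s} - {p}. C i j * d' i)"
        using p by (subst sum.remove[of _ p]) auto
      also have "(\<Sum>i\<in>{..<s} - {p}. C i j * d' i) = (\<Sum>i<t. C (e i) j * d' (e i))"
        using sum.reindex_bij_betw[OF bij, of "\<lambda>i. C i j * d' i"] by simp
      also have "\<dots> = (\<Sum>i<t. C (e i) j * (C p r * d i))"
        by (intro sum.cong) (auto simp: d'_def ne fe)
      finally show ?thesis
        by (simp add: d'_def sum_distrib_left sum_distrib_right sum_subtractf algebra_simps)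
    qed
    have "\<exists>i<s. d' i \<noteq> 0"
    proof -
      obtain i where i: "i < t" "d i \<noteq> 0" using d by auto
      have "e i < s" using i s by (auto simp: e_def)
      moreover have "d' (e i) = C p r * d i" using fe[OF i(1)] by (auto simp: d'_def e_def)
      ultimately show ?thesis using i p by (intro exI[of _ "e i"]) auto
    qed
    moreover have "(\<Sum>i<s. C i j * d' i) = 0" if "j < Suc r" for j
      using that d(2) unfolding sum by (cases "j = r") (auto simp: algebra_simps)
    ultimately show ?thesis by blast
  qed
qed

section \<open>Uniqueness and existence of the rank\<close>

context comm_group
begin

text \<open>Steinitz bound up to torsion: nonzero multiples of the \<open>y i\<close> are
  combinations of \<open>r\<close> elements, so more than \<open>r\<close> of them satisfy a
  nontrivial relation. It stays nontrivial for the \<open>y i\<close> since all multipliers are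
  nonzero.\<close>

lemma zindep_le_rank:
  assumes "has_rank G S r" "S \<subseteq> carrier G" "y \<in> {..<s} \<rightarrow> S" "zindep G s y"
  shows "s \<le> r"
proof (rule ccontr)
  assume "\<not> s \<le> r"
  then have rs: "r < s" by simp
  obtain x where x: "x \<in> {..<r} \<rightarrow> S"
    and sp: "\<And>g. g \<in> S \<Longrightarrow> \<exists>m c. m \<noteq> (0::int) \<and> g [^] m = zcomb G r x c"
    using assms(1) by (auto simp: has_rank_def)
  have xc: "x \<in> {..<r} \<rightarrow> carrier G" and yc: "y \<in> {..<s} \<rightarrow> carrier G"
    using x assms by auto
  have "\<forall>i. \<exists>m c. i < s \<longrightarrow> m \<noteq> (0::int) \<and> y i [^] m = zcomb G r x c"
    using sp assms(3) by blast
  then obtain m C where mC: "\<And>i. i < s \<Longrightarrow> m i \<noteq> (0::int) \<and> y i [^] m i = zcomb G r x (C i)"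
    by metis
  obtain d where d: "\<exists>i<s. d i \<noteq> 0" "\<forall>j<r. (\<Sum>i<s. C i j * d i) = 0"
    using nontrivial_integer_solution[OF rs] by blast
  have "zcomb G s y (\<lambda>i. m i * d i) = zcomb G s (\<lambda>i. zcomb G r x (C i)) d"
    unfolding zcomb_def[of G s] using yc xc mC
    by (intro finprod_cong') (auto simp: Pi_iff simp flip: int_pow_pow)
  also have "\<dots> = zcomb G r x (\<lambda>j. 0)"
    unfolding zcomb_zcomb[OF xc] using d(2) xc by (intro zcomb_cong) auto
  finally have "zcomb G s y (\<lambda>i. m i * d i) = \<one>" by simp
  then have "\<forall>i<s. m i * d i = 0"
    using assms(4) unfolding zindep_def by blast
  then show False using d mC by auto
qed

lemma has_rank_unique:
  assumes "has_rank G S r" "has_rank G S s" "S \<subseteq> carrier G"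
  shows "r = s"
proof (rule order_antisym)
  show "r \<le> s" using zindep_le_rank[OF assms(2,3)] assms(1) by (auto simp: has_rank_def)
  show "s \<le> r" using zindep_le_rank[OF assms(1,3)] assms(2) by (auto simp: has_rank_def)
qed

text \<open>An independent family of maximal length spans up to torsion; the bound \<open>N\<close>
  guarantees that a maximal length exists.\<close>

lemma has_rank_exists:
  assumes S: "S \<subseteq> carrier G"
    and bound: "\<And>s y. y \<in> {..<s} \<rightarrow> S \<Longrightarrow> zindep G s y \<Longrightarrow> s \<le> N"
  shows "\<exists>r\<le>N. has_rank G S r"
proof -
  let ?Q = "\<lambda>s. \<exists>y. y \<in> {..<s} \<rightarrow> S \<and> zindep G s y"
  have "?Q 0" by (auto simp: zindep_def)
  moreover have b: "\<forall>s. ?Q s \<longrightarrow> s \<le> N" using bound by blast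
  ultimately obtain r where r: "?Q r" "\<And>s. ?Q s \<Longrightarrow> s \<le> r"
    using ex_has_greatest_nat[of ?Q 0 id "Suc N"] by (auto simp: less_Suc_eq_le)
  then obtain x where x: "x \<in> {..<r} \<rightarrow> S" "zindep G r x" by blast
  have xc: "x \<in> {..<r} \<rightarrow> carrier G" using x S by auto
  have "\<exists>m c. m \<noteq> (0::int) \<and> g [^] m = zcomb G r x c" if g: "g \<in> S" for g
  proof -
    let ?y = "x(r := g)"
    have gc: "g \<in> carrier G" using g S by blast
    have y: "?y \<in> {..<Suc r} \<rightarrow> S" using x g by (auto simp: less_Suc_eq)
    then have yc: "?y \<in> {..<Suc r} \<rightarrow> carrier G" using S by auto
    have "\<not> zindep G (Suc r) ?y" using r(2)[of "Suc r"] y by auto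
    then obtain c i where c: "zcomb G (Suc r) ?y c = \<one>" "i < Suc r" "c i \<noteq> 0"
      by (auto simp: zindep_def)
    have "zcomb G r ?y c = zcomb G r x c"
      using xc by (intro zcomb_cong) auto
    then have 1: "zcomb G r x c \<otimes> g [^] c r = \<one>"
      using c(1) yc by (simp add: zcomb_Suc)
    \<comment> \<open>The relation must involve \<open>g\<close>, since otherwise it would be one
      among the independent \<open>x i\<close>. Its exponent at \<open>g\<close> then serves as the
      required multiplier.\<close>
    have "c r \<noteq> 0"
    proof
      assume "c r = 0"
      then have "zcomb G r x c = \<one>" using 1 xc by simp
      then show False using x(2) c \<open>c r = 0\<close> by (auto simp: zindep_def less_Suc_eq)
    qed
    moreover have "g [^] c r = zcomb G r x (\<lambda>i. - c i)"
      using inv_equality[of "g [^] c r" "zcomb G r x c"] 1 gc xc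
      by (simp add: zcomb_uminus m_comm)
    ultimately show ?thesis by blast
  qed
  then have "has_rank G S r" using x unfolding has_rank_def by (intro exI[of _ x]) simp
  moreover have "r \<le> N" using r(1) b by blast
  ultimately show ?thesis by blast
qed

end

text \<open>Rank-nullity: a basis of the kernel followed by lifts of a basis of the image is a
  basis, all up to torsion.\<close>

lemma has_rank_append:
  assumes G: "comm_group G" and H: "comm_group H" and f: "f \<in> hom G H"
    and a: "has_rank G (kernel G H f) a" and b: "has_rank H (f ` carrier G) b"
  shows "has_rank G (carrier G) (a + b)"
proof -
  interpret G: comm_group G by fact
  interpret H: comm_group H by fact
  interpret group_hom G H f using f by unfold_locales
  obtain x where x: "x \<in> {..<a} \<rightarrow> kernel G H f" "zindep G a x"
    and xs: "\<And>g. g \<in> kernel G H f \<Longrightarrow> \<exists>m c. m \<noteq> (0::int) \<and> g [^]\<^bsub>G\<^esub> m = zcomb G a x c"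
    using a by (auto simp: has_rank_def)
  obtain y where y: "y \<in> {..<b} \<rightarrow> f ` carrier G" "zindep H b y"
    and ys: "\<And>g. g \<in> f ` carrier G \<Longrightarrow> \<exists>m c. m \<noteq> (0::int) \<and> g [^]\<^bsub>H\<^esub> m = zcomb H b y c"
    using b unfolding has_rank_def by blast
  define z where "z i = inv_into (carrier G) f (y i)" for i
  have z: "z i \<in> carrier G \<and> f (z i) = y i" if "i < b" for i
    using y(1) that by (auto simp: z_def Pi_iff inv_into_into f_inv_into_f)
  have xc: "x \<in> {..<a} \<rightarrow> carrier G" using x by (auto simp: kernel_def)
  have zc: "z \<in> {..<b} \<rightarrow> carrier G" using z by auto
  have yc: "y \<in> {..<b} \<rightarrow> carrier H" using z by (metis Pi_I lessThan_iff hom_closed)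
  have fx: "f (zcomb G a x c) = \<one>\<^bsub>H\<^esub>" for c
  proof -
    have "f (zcomb G a x c) = zcomb H a (\<lambda>i. f (x i)) c"
      by (rule zcomb_hom[OF G H f xc])
    also have "\<dots> = zcomb H a (\<lambda>i. \<one>\<^bsub>H\<^esub>) c"
      using x by (intro H.zcomb_cong) (auto simp: kernel_def)
    also have "\<dots> = \<one>\<^bsub>H\<^esub>" by (simp add: zcomb_def)
    finally show ?thesis .
  qed
  have fz: "f (zcomb G b z c) = zcomb H b y c" for c
    using zcomb_hom[OF G H f zc] H.zcomb_cong[OF _ _ yc, of "\<lambda>i. f (z i)" c c] z by simp
  let ?w = "\<lambda>i. if i < a then x i else z (i - a)"
  have w: "?w \<in> {..<a + b} \<rightarrow> carrier G"
    using xc zc by (auto simp: Pi_iff)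
  note app = G.zcomb_append[OF xc zc]
  have "zindep G (a + b) ?w"
    unfolding zindep_def
  proof (intro allI impI)
    fix c i assume c: "zcomb G (a + b) ?w c = \<one>\<^bsub>G\<^esub>" and i: "i < a + b"
    have "f (zcomb G (a + b) ?w c) = zcomb H b y (\<lambda>i. c (a + i))"
      unfolding app using xc zc yc by (simp add: fx fz)
    then have "zcomb H b y (\<lambda>i. c (a + i)) = \<one>\<^bsub>H\<^esub>" using c by simp
    then have y0: "\<forall>i<b. c (a + i) = 0"
      using y(2) unfolding zindep_def by blast
    then have "zcomb G b z (\<lambda>i. c (a + i)) = zcomb G b z (\<lambda>i. 0)"
      using zc by (intro G.zcomb_cong) auto
    then have "zcomb G a x c = \<one>\<^bsub>G\<^esub>" using c app[of c] xc by simp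
    then have "\<forall>i<a. c i = 0" using x(2) by (simp add: zindep_def)
    then show "c i = 0" using y0 i
      by (metis add_diff_inverse_nat nat_add_left_cancel_less)
  qed
  moreover have "\<exists>m c. m \<noteq> (0::int) \<and> g [^]\<^bsub>G\<^esub> m = zcomb G (a + b) ?w c" if g: "g \<in> carrier G" for g
  proof -
    obtain m c where m: "m \<noteq> (0::int)" "f g [^]\<^bsub>H\<^esub> m = zcomb H b y c" using ys g by blast
    \<comment> \<open>A power of \<open>g\<close> agrees in the image with a combination of the
      lifts \<open>z\<close>. The discrepancy \<open>h\<close> lies in the kernel, where a second
      power brings it into the span of \<open>x\<close>.\<close>
    define h where "h = g [^]\<^bsub>G\<^esub> m \<otimes>\<^bsub>G\<^esub> inv\<^bsub>G\<^esub> zcomb G b z c"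
    have hc: "h \<in> carrier G" using g zc by (simp add: h_def)
    have "f h = \<one>\<^bsub>H\<^esub>"
      using g zc yc m(2) by (simp add: h_def hom_int_pow fz)
    then have "h \<in> kernel G H f" using hc by (simp add: kernel_def)
    then obtain l d where l: "l \<noteq> (0::int)" "h [^]\<^bsub>G\<^esub> l = zcomb G a x d" using xs by blast
    have "g [^]\<^bsub>G\<^esub> m = h \<otimes>\<^bsub>G\<^esub> zcomb G b z c"
      using g zc by (simp add: h_def G.m_assoc)
    then have "g [^]\<^bsub>G\<^esub> (m * l) = zcomb G a x d \<otimes>\<^bsub>G\<^esub> zcomb G b z (\<lambda>i. c i * l)"
      using g zc hc l(2) by (simp add: G.int_pow_distrib G.zcomb_mult flip: G.int_pow_pow)
    also have "\<dots> = zcomb G (a + b) ?w (\<lambda>i. if i < a then d i else c (i - a) * l)"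
      unfolding app using xc zc by (intro arg_cong2[where f = "mult G"] G.zcomb_cong) auto
    finally show ?thesis using m l by (intro exI[of _ "m * l"]) auto
  qed
  ultimately show ?thesis unfolding has_rank_def using w by (intro exI[of _ ?w]) simp
qed

text \<open>Independent families in the kernel are independent in \<open>G\<close>, and those in the
  image lift to independent ones. Hence \<open>r\<close> bounds the length of both, and the two
  ranks exist.\<close>

lemma has_rank_split:
  assumes G: "comm_group G" and H: "comm_group H" and f: "f \<in> hom G H"
    and r: "has_rank G (carrier G) r"
  obtains a b where "has_rank G (kernel G H f) a" "has_rank H (f ` carrier G) b" "r = a + b"
proof -
  interpret G: comm_group G by fact
  interpret H: comm_group H by fact
  interpret group_hom G H f using f by unfold_locales
  obtain a where a: "has_rank G (kernel G H f) a"
  proof -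
    have "s \<le> r" if "y \<in> {..<s} \<rightarrow> kernel G H f" "zindep G s y" for s y
      by (rule G.zindep_le_rank[OF r _ _ that(2)]) (use that in \<open>auto simp: kernel_def\<close>)
    then show ?thesis
      using G.has_rank_exists[of "kernel G H f" r] that by (auto simp: kernel_def)
  qed
  obtain b where b: "has_rank H (f ` carrier G) b"
  proof -
    have "s \<le> r" if y: "y \<in> {..<s} \<rightarrow> f ` carrier G" "zindep H s y" for s y
    proof -
      define z where "z i = inv_into (carrier G) f (y i)" for i
      have z: "z i \<in> carrier G \<and> f (z i) = y i" if "i < s" for i
        using y(1) that by (auto simp: z_def Pi_iff inv_into_into f_inv_into_f)
      have zc: "z \<in> {..<s} \<rightarrow> carrier G" using z by auto
      have yc: "y \<in> {..<s} \<rightarrow> carrier H" using z by (metis Pi_I lessThan_iff hom_closed)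
      have fz: "f (zcomb G s z c) = zcomb H s y c" for c
        using zcomb_hom[OF G H f zc] H.zcomb_cong[OF _ _ yc, of "\<lambda>i. f (z i)" c c] z by simp
      have "zindep G s z"
        using y(2) fz unfolding zindep_def by (metis hom_one)
      then show ?thesis using G.zindep_le_rank[OF r _ zc] by simp
    qed
    then show ?thesis
      using H.has_rank_exists[of "f ` carrier G" r] that hom_carrier[OF f] by blast
  qed
  have "r = a + b"
    using G.has_rank_unique[OF r has_rank_append[OF G H f a b]] by simp
  then show ?thesis using that a b by blast
qed

lemma has_rank_iso:
  assumes G: "comm_group G" and H: "comm_group H" and iso: "G \<cong> H" and r: "has_rank G (carrier G) r"
  shows "has_rank H (carrier H) r"
proof -
  interpret G: comm_group G by fact
  interpret H: comm_group H by fact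
  obtain f where f: "f \<in> hom G H" "bij_betw f (carrier G) (carrier H)"
    using iso by (auto simp: is_iso_def iso_def)
  interpret group_hom G H f using f by unfold_locales
  obtain a b where ab: "has_rank G (kernel G H f) a" "has_rank H (f ` carrier G) b" "r = a + b"
    using has_rank_split[OF G H f(1) r] .
  have ker: "kernel G H f = {\<one>\<^bsub>G\<^esub>}"
    using f(2) inj_iff_trivial_ker by (simp add: bij_betw_def)
  have "has_rank G {\<one>\<^bsub>G\<^esub>} 0"
    by (auto simp: has_rank_def zindep_def intro: exI[of _ 1])
  then have "a = 0" using G.has_rank_unique ab(1) ker by auto
  then show ?thesis using ab f(2) by (simp add: bij_betw_def)
qed

lemma has_rank_trivial:
  assumes "comm_group G" "trivial_group G"
  shows "has_rank G (carrier G) 0"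
proof -
  interpret comm_group G by fact
  show ?thesis
    using assms(2) by (auto simp: has_rank_def zindep_def trivial_group_def intro: exI[of _ 1])
qed

lemma has_rank_integer_group: "has_rank integer_group (carrier integer_group) 1"
proof -
  interpret comm_group integer_group by (rule abelian_integer_group)
  have 1: "zcomb integer_group (Suc 0) (\<lambda>_. 1) c = c 0" for c
    by (subst zcomb_Suc) auto
  show ?thesis
    unfolding has_rank_def
    by (intro exI[of _ "\<lambda>_. 1"]) (auto simp: zindep_def 1 intro!: exI[of _ 1])
qed

section \<open>Euler characteristic of pairs of spaces\<close>

text \<open>A relation rather than a function, because the ranks may fail to be finite. Negative
  degrees are left out since homology vanishes there. \<open>S = {}\<close> gives the absolute Euler
  characteristic.\<close>

definition has_euler :: "'a topology \<Rightarrow> 'a set \<Rightarrow> int \<Rightarrow> bool"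
  where "has_euler X S m \<longleftrightarrow> (\<exists>r N.
    (\<forall>q. has_rank (relative_homology_group (int q) X S)
           (carrier (relative_homology_group (int q) X S)) (r q)) \<and>
    (\<forall>q\<ge>N. r q = 0) \<and> m = (\<Sum>q<N. (-1) ^ q * int (r q)))"

lemma alternating_sum_extend:
  fixes r :: "nat \<Rightarrow> nat"
  assumes "\<forall>q\<ge>N. r q = 0" "N \<le> M"
  shows "(\<Sum>q<M. (-1) ^ q * int (r q)) = (\<Sum>q<N. (-1) ^ q * int (r q))"
  by (rule sum.mono_neutral_right) (use assms in auto)

lemma has_euler_unique:
  assumes "has_euler X S a" "has_euler X S b"
  shows "a = b"
proof -
  let ?R = "\<lambda>q. relative_homology_group (int q) X S"
  obtain r N where r: "\<And>q. has_rank (?R q) (carrier (?R q)) (r q)" "\<forall>q\<ge>N. r q = 0"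
      "a = (\<Sum>q<N. (-1) ^ q * int (r q))"
    using assms(1) by (auto simp: has_euler_def)
  obtain s M where s: "\<And>q. has_rank (?R q) (carrier (?R q)) (s q)" "\<forall>q\<ge>M. s q = 0"
      "b = (\<Sum>q<M. (-1) ^ q * int (s q))"
    using assms(2) by (auto simp: has_euler_def)
  have "r q = s q" for q
    using comm_group.has_rank_unique[OF abelian_relative_homology_group r(1) s(1)] by simp
  then have "r = s" by blast
  then show ?thesis
    using alternating_sum_extend[OF r(2), of "max N M"] alternating_sum_extend[OF s(2), of "max N M"] r(3) s(3)
    by simp
qed

section \<open>Additivity along the long exact sequence of a pair\<close>

lemma alternating_telescope:
  fixes D :: "nat \<Rightarrow> int"
  shows "(\<Sum>q<N. (-1) ^ q * (D q + D (Suc q))) = D 0 - (-1) ^ N * D N"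
  by (induction N) (auto simp: algebra_simps)

lemma hom_image_trivial_group:
  assumes "group G" "group H" "f \<in> hom G H" "trivial_group H"
  shows "f ` carrier G = carrier H"
proof -
  interpret group_hom G H f using assms by (simp add: group_hom_def group_hom_axioms_def)
  have H: "carrier H = {\<one>\<^bsub>H\<^esub>}" using assms(4) by (simp add: trivial_group_def)
  have "f x = \<one>\<^bsub>H\<^esub>" if "x \<in> carrier G" for x using hom_closed[OF that] H by simp
  then show ?thesis using H G.one_closed by force
qed

text \<open>By exactness the ranks are \<open>r = D + I\<close>, \<open>s = I + J\<close> and
  \<open>t = J + E\<close>, where \<open>E\<close> is \<open>D\<close> shifted by one degree. So
  \<open>t - s + r\<close> is \<open>E q + E (Suc q)\<close>, and its alternating sum
  telescopes.\<close>

lemma has_euler_relative: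
  assumes "has_euler (subtopology X S) {} a" "has_euler X {} b"
  shows "has_euler X S (b - a)"
proof -
  let ?P = "\<lambda>q. homology_group q (subtopology X S)"
  let ?Q = "\<lambda>q. homology_group q X"
  let ?R = "\<lambda>q. relative_homology_group q X S"
  let ?i = "\<lambda>q. hom_induced q (subtopology X S) {} X {} id"
  let ?j = "\<lambda>q. hom_induced q X {} X S id"
  let ?d = "\<lambda>q. hom_boundary q X S"
  obtain r N where r: "\<And>q. has_rank (?P (int q)) (carrier (?P (int q))) (r q)" "\<forall>q\<ge>N. r q = 0"
      "a = (\<Sum>q<N. (-1) ^ q * int (r q))"
    using assms(1) by (auto simp: has_euler_def)
  obtain s M where s: "\<And>q. has_rank (?Q (int q)) (carrier (?Q (int q))) (s q)" "\<forall>q\<ge>M. s q = 0"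
      "b = (\<Sum>q<M. (-1) ^ q * int (s q))"
    using assms(2) by (auto simp: has_euler_def)
  have "\<exists>D I. has_rank (?P (int q)) (kernel (?P (int q)) (?Q (int q)) (?i (int q))) D \<and>
      has_rank (?Q (int q)) (?i (int q) ` carrier (?P (int q))) I \<and> r q = D + I" for q
    by (rule has_rank_split[OF abelian_homology_group abelian_homology_group hom_induced_hom r(1)[of q]]) blast
  then obtain D I where DI: "\<And>q. has_rank (?P (int q)) (kernel (?P (int q)) (?Q (int q)) (?i (int q))) (D q)"
      "\<And>q. has_rank (?Q (int q)) (?i (int q) ` carrier (?P (int q))) (I q)" "\<And>q. r q = D q + I q"
    by metis
  have "\<exists>J. has_rank (?R (int q)) (?j (int q) ` carrier (?Q (int q))) J \<and> s q = I q + J" for q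
  proof -
    obtain I' J where *: "has_rank (?Q (int q)) (kernel (?Q (int q)) (?R (int q)) (?j (int q))) I'"
       "has_rank (?R (int q)) (?j (int q) ` carrier (?Q (int q))) J" "s q = I' + J"
      by (rule has_rank_split[OF abelian_homology_group abelian_relative_homology_group hom_induced_hom s(1)[of q]])
    have "kernel (?Q (int q)) (?R (int q)) (?j (int q)) = ?i (int q) ` carrier (?P (int q))"
      using homology_exactness_axiom_3[of "int q" X S] by simp
    then have "I' = I q"
      using comm_group.has_rank_unique[OF abelian_homology_group *(1), of "I q"] DI(2)[of q]
        hom_carrier[OF hom_induced_hom, of "int q" "subtopology X S" "{}" X "{}" id] by metis
    then show ?thesis using * by blast
  qed
  then obtain J where J: "\<And>q. has_rank (?R (int q)) (?j (int q) ` carrier (?Q (int q))) (J q)"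
      "\<And>q. s q = I q + J q"
    by metis
  \<comment> \<open>The image of the boundary map in degree \<open>q\<close> is the kernel of the
    inclusion map in degree \<open>q - 1\<close>; for \<open>q = 0\<close> it lies in a trivial
    group.\<close>
  define E where "E q = (case q of 0 \<Rightarrow> 0 | Suc p \<Rightarrow> D p)" for q
  define t where "t q = J q + E q" for q
  have t: "has_rank (?R (int q)) (carrier (?R (int q))) (t q)" for q
    unfolding t_def
  proof (rule has_rank_append[OF abelian_relative_homology_group abelian_homology_group hom_boundary_hom])
    have "kernel (?R (int q)) (?P (int q - 1)) (?d (int q)) = ?j (int q) ` carrier (?Q (int q))"
      using homology_exactness_axiom_1[of "int q" X S] by simp
    then show "has_rank (?R (int q)) (kernel (?R (int q)) (?P (int q - 1)) (?d (int q))) (J q)"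
      using J by simp
    show "has_rank (?P (int q - 1)) (?d (int q) ` carrier (?R (int q))) (E q)"
    proof (cases q)
      case 0
      let ?T = "?P (int q - 1)"
      have triv: "trivial_group ?T" using 0 by simp
      have "?d (int q) ` carrier (?R (int q)) = carrier ?T"
        by (rule hom_image_trivial_group[OF _ _ hom_boundary_hom triv]) simp_all
      then show ?thesis
        using has_rank_trivial[OF abelian_homology_group triv] 0 by (simp add: E_def)
    next
      case (Suc p)
      have "kernel (?P (int p)) (?Q (int p)) (?i (int p)) = ?d (int q) ` carrier (?R (int q))"
        using homology_exactness_axiom_2[of "int q" X S] Suc by simp
      then show ?thesis using DI(1)[of p] Suc by (simp add: E_def)
    qed
  qed
  \<comment> \<open>One degree beyond both bounds, because \<open>E\<close> lags behind
    \<open>D\<close> by one.\<close>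
  define L where "L = Suc (max N M)"
  have E0: "E q = 0" if "q \<ge> L" for q
    using that DI(3)[of "q - 1"] r(2) by (auto simp: E_def L_def split: nat.split)
  have t0: "t q = 0" if "q \<ge> L" for q
    using that E0[OF that] J(2)[of q] s(2) by (auto simp: t_def L_def)
  have "(\<Sum>q<L. (-1) ^ q * int (t q)) - (\<Sum>q<L. (-1) ^ q * int (s q)) + (\<Sum>q<L. (-1) ^ q * int (r q)) =
      (\<Sum>q<L. (-1) ^ q * (int (E q) + int (E (Suc q))))"
    unfolding sum_subtractf[symmetric] sum.distrib[symmetric]
    by (intro sum.cong) (auto simp: t_def J(2) DI(3) E_def algebra_simps)
  also have "\<dots> = 0"
    using alternating_telescope[of "\<lambda>q. int (E q)" L] E0[of L] by (simp add: E_def)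
  finally have "(\<Sum>q<L. (-1) ^ q * int (t q)) = b - a"
    using alternating_sum_extend[OF r(2), of L] alternating_sum_extend[OF s(2), of L] r(3) s(3)
    by (simp add: L_def)
  then show ?thesis
    unfolding has_euler_def using t t0 by (intro exI[of _ t] exI[of _ L]) auto
qed

text \<open>The same exact sequence with a different unknown: finiteness of the homology of
  \<open>X\<close> is now a conclusion, so its ranks are assembled from the image ranks
  \<open>I\<close> and \<open>J\<close>.\<close>

lemma has_euler_absolute:
  assumes "has_euler (subtopology X S) {} a" "has_euler X S c"
  shows "has_euler X {} (a + c)"
proof -
  let ?P = "\<lambda>q. homology_group q (subtopology X S)"
  let ?Q = "\<lambda>q. homology_group q X"
  let ?R = "\<lambda>q. relative_homology_group q X S"
  let ?i = "\<lambda>q. hom_induced q (subtopology X S) {} X {} id"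
  let ?j = "\<lambda>q. hom_induced q X {} X S id"
  let ?d = "\<lambda>q. hom_boundary q X S"
  obtain r N where r: "\<And>q. has_rank (?P (int q)) (carrier (?P (int q))) (r q)" "\<forall>q\<ge>N. r q = 0"
      "a = (\<Sum>q<N. (-1) ^ q * int (r q))"
    using assms(1) by (auto simp: has_euler_def)
  obtain t M where t: "\<And>q. has_rank (?R (int q)) (carrier (?R (int q))) (t q)" "\<forall>q\<ge>M. t q = 0"
      "c = (\<Sum>q<M. (-1) ^ q * int (t q))"
    using assms(2) by (auto simp: has_euler_def)
  have "\<exists>D I. has_rank (?P (int q)) (kernel (?P (int q)) (?Q (int q)) (?i (int q))) D \<and>
      has_rank (?Q (int q)) (?i (int q) ` carrier (?P (int q))) I \<and> r q = D + I" for q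
    by (rule has_rank_split[OF abelian_homology_group abelian_homology_group hom_induced_hom r(1)[of q]]) blast
  then obtain D I where DI: "\<And>q. has_rank (?P (int q)) (kernel (?P (int q)) (?Q (int q)) (?i (int q))) (D q)"
      "\<And>q. has_rank (?Q (int q)) (?i (int q) ` carrier (?P (int q))) (I q)" "\<And>q. r q = D q + I q"
    by metis
  have "\<exists>J E. has_rank (?R (int q)) (?j (int q) ` carrier (?Q (int q))) J \<and>
      has_rank (?P (int q - 1)) (?d (int q) ` carrier (?R (int q))) E \<and> t q = J + E" for q
  proof -
    have "kernel (?R (int q)) (?P (int q - 1)) (?d (int q)) = ?j (int q) ` carrier (?Q (int q))"
      using homology_exactness_axiom_1[of "int q" X S] by simp
    then show ?thesis
      using has_rank_split[OF abelian_relative_homology_group abelian_homology_group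
          hom_boundary_hom t(1)[of q]] by metis
  qed
  then obtain J E where JE: "\<And>q. has_rank (?R (int q)) (?j (int q) ` carrier (?Q (int q))) (J q)"
      "\<And>q. has_rank (?P (int q - 1)) (?d (int q) ` carrier (?R (int q))) (E q)" "\<And>q. t q = J q + E q"
    by metis
  have E0: "E 0 = 0"
  proof -
    let ?T = "?P (-1)"
    have triv: "trivial_group ?T" by simp
    have "?d 0 ` carrier (?R 0) = carrier ?T"
      using hom_image_trivial_group[OF _ _ hom_boundary_hom[of 0 X S]] triv by simp
    then show ?thesis
      using comm_group.has_rank_unique[OF abelian_homology_group has_rank_trivial[OF abelian_homology_group triv]]
        JE(2)[of 0] by simp
  qed
  have ES: "E (Suc q) = D q" for q
  proof -
    have "kernel (?P (int q)) (?Q (int q)) (?i (int q)) = ?d (int (Suc q)) ` carrier (?R (int (Suc q)))"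
      using homology_exactness_axiom_2[of "int (Suc q)" X S] by simp
    then have "has_rank (?P (int q)) (kernel (?P (int q)) (?Q (int q)) (?i (int q))) (E (Suc q))"
      using JE(2)[of "Suc q"] by simp
    from comm_group.has_rank_unique[OF abelian_homology_group this DI(1)[of q]] show ?thesis
      by (auto simp: kernel_def simp del: one_relative_homology_group)
  qed
  define s where "s q = I q + J q" for q
  have s: "has_rank (?Q (int q)) (carrier (?Q (int q))) (s q)" for q
    unfolding s_def
  proof (rule has_rank_append[OF abelian_homology_group abelian_relative_homology_group hom_induced_hom])
    have "kernel (?Q (int q)) (?R (int q)) (?j (int q)) = ?i (int q) ` carrier (?P (int q))"
      using homology_exactness_axiom_3[of "int q" X S] by simp
    then show "has_rank (?Q (int q)) (kernel (?Q (int q)) (?R (int q)) (?j (int q))) (I q)"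
      using DI(2)[of q] by simp
    show "has_rank (?R (int q)) (?j (int q) ` carrier (?Q (int q))) (J q)" by (rule JE(1))
  qed
  define L where "L = Suc (max N M)"
  have L0: "E L = 0" using JE(3)[of L] t(2) by (simp add: L_def)
  have s0: "s q = 0" if "q \<ge> L" for q
    using that DI(3)[of q] JE(3)[of q] r(2) t(2) by (auto simp: s_def L_def)
  have "(\<Sum>q<L. (-1) ^ q * int (t q)) - (\<Sum>q<L. (-1) ^ q * int (s q)) + (\<Sum>q<L. (-1) ^ q * int (r q)) =
      (\<Sum>q<L. (-1) ^ q * (int (E q) + int (E (Suc q))))"
    unfolding sum_subtractf[symmetric] sum.distrib[symmetric]
    by (intro sum.cong) (auto simp: s_def JE(3) DI(3) ES algebra_simps)
  also have "\<dots> = 0"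
    using alternating_telescope[of "\<lambda>q. int (E q)" L] by (simp add: L0 E0)
  finally have "(\<Sum>q<L. (-1) ^ q * int (s q)) = a + c"
    using alternating_sum_extend[OF r(2), of L] alternating_sum_extend[OF t(2), of L] r(3) t(3)
    by (simp add: L_def)
  then show ?thesis
    unfolding has_euler_def using s s0 by (intro exI[of _ s] exI[of _ L]) auto
qed

section \<open>Pairs with known homology\<close>

lemma has_euler_trivial:
  assumes "\<And>q. trivial_group (relative_homology_group q X S)"
  shows "has_euler X S 0"
  unfolding has_euler_def
  by (rule exI[of _ "\<lambda>_. 0"], rule exI[of _ 0])
    (simp add: assms has_rank_trivial)

lemma has_euler_iso:
  assumes "has_euler X S a" "\<And>q. relative_homology_group q X S \<cong> relative_homology_group q Y T"
  shows "has_euler Y T a"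
  using assms(1) has_rank_iso[OF abelian_relative_homology_group abelian_relative_homology_group assms(2)]
  unfolding has_euler_def by blast

lemma has_euler_single:
  assumes "relative_homology_group (int k) X S \<cong> integer_group"
    and "\<And>q. q \<noteq> int k \<Longrightarrow> trivial_group (relative_homology_group q X S)"
  shows "has_euler X S ((-1) ^ k)"
proof -
  have "has_rank (relative_homology_group (int q) X S) (carrier (relative_homology_group (int q) X S))
      (if q = k then 1 else 0)" for q
  proof (cases "q = k")
    case True
    have "integer_group \<cong> relative_homology_group (int k) X S"
      using assms(1) group.iso_sym group_relative_homology_group by blast
    then show ?thesis
      using True has_rank_iso[OF abelian_integer_group abelian_relative_homology_group _ has_rank_integer_group]
      by simp
  next
    case False
    then show ?thesis using assms(2)[of "int q"] by (simp add: has_rank_trivial)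
  qed
  then show ?thesis
    unfolding has_euler_def
    by (intro exI[of _ "\<lambda>q. if q = k then 1 else 0"] exI[of _ "Suc k"]) (auto simp: if_distrib cong: if_cong)
qed

lemma has_euler_contractible:
  assumes "contractible_space X" "topspace X \<noteq> {}"
  shows "has_euler X {} 1"
proof -
  have "has_euler X {} ((-1) ^ 0)"
  proof (rule has_euler_single)
    show "homology_group (int 0) X \<cong> integer_group"
      using isomorphic_integer_zeroth_homology_group[OF contractible_imp_path_connected_space[OF assms(1)] assms(2)]
      by simp
    show "trivial_group (homology_group q X)" if "q \<noteq> int 0" for q
      using that trivial_reduced_homology_group_contractible_space[OF assms(1), of q]
      by (simp add: un_reduced_homology_group)
  qed
  then show ?thesis by simp
qed

text \<open>Homology relative to a point is reduced homology, which lives in degree \<open>n\<close>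
  only; the point itself adds 1. For \<open>n = 0\<close> this gives the two points of the
  0-sphere.\<close>

lemma has_euler_nsphere: "has_euler (nsphere n) {} (1 + (-1) ^ n)"
proof (rule has_euler_absolute)
  let ?a = "\<lambda>m. if m = (0::nat) then 1 else (0::real)"
  have a: "?a \<in> topspace (nsphere n)" by (rule in_topspace_nsphere)
  show "has_euler (subtopology (nsphere n) {?a}) {} 1"
    by (rule has_euler_contractible) (use a in \<open>auto simp: contractible_space_subtopology_singleton\<close>)
  show "has_euler (nsphere n) {?a} ((-1) ^ n)"
  proof (rule has_euler_single)
    have "relative_homology_group q (nsphere n) {?a} \<cong> reduced_homology_group q (nsphere n)" for q
      by (rule isomorphic_relative_homology_by_singleton[OF a])
    then show "relative_homology_group (int n) (nsphere n) {?a} \<cong> integer_group"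
      using reduced_homology_group_nsphere(1) iso_trans by blast
    show "trivial_group (relative_homology_group q (nsphere n) {?a})" if "q \<noteq> int n" for q
      using reduced_homology_group_nsphere(2)[OF that]
        isomorphic_group_triviality[OF isomorphic_relative_homology_by_singleton[OF a]]
      by simp
  qed
qed

section \<open>Attaching a cell\<close>

lemma Euclidean_space_top_of_set: "Euclidean_space n = top_of_set {x. \<forall>i\<ge>n. x i = 0}"
  by (simp add: Euclidean_space_def euclidean_product_topology)

lemma topspace_closed_ball:
  "topspace (closed_ball k) = {x. (\<forall>i\<ge>k. x i = 0) \<and> (\<Sum>i<k. (x i)\<^sup>2) \<le> 1}"
  by (auto simp: closed_ball_def topspace_Euclidean_space)

lemma closed_ball_top_of_set: "closed_ball k = top_of_set (topspace (closed_ball k))"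
  unfolding topspace_closed_ball
  by (simp add: closed_ball_def Euclidean_space_top_of_set subtopology_subtopology Collect_conj_eq)

lemma open_ball_eq: "open_ball k = {x. (\<forall>i\<ge>k. x i = 0) \<and> (\<Sum>i<k. (x i)\<^sup>2) < 1}"
  by (auto simp: open_ball_def topspace_Euclidean_space)

text \<open>Indexed by the dimension of the ball, so that \<open>bsphere 0\<close> is empty, the
  boundary of a single point. The spheres \<open>nsphere\<close> start one dimension higher.\<close>

definition bsphere :: "nat \<Rightarrow> (nat \<Rightarrow> real) set"
  where "bsphere k = topspace (closed_ball k) - open_ball k"

lemma bsphere_eq: "bsphere k = {x. (\<forall>i\<ge>k. x i = 0) \<and> (\<Sum>i<k. (x i)\<^sup>2) = 1}"
  by (auto simp: bsphere_def topspace_closed_ball open_ball_eq)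

lemma Hausdorff_closed_ball: "Hausdorff_space (closed_ball k)"
  by (simp add: closed_ball_def Hausdorff_Euclidean_space Hausdorff_space_subtopology)

lemma continuous_on_snd_coordinate: "continuous_on S (\<lambda>z::real \<times> (nat \<Rightarrow> real). snd z i)"
  by (rule continuous_on_compose2[OF continuous_on_product_coordinates continuous_on_snd[OF continuous_on_id]]) auto

lemma sum_square_convex:
  fixes x y :: "nat \<Rightarrow> real"
  assumes "0 \<le> t" "t \<le> 1" "(\<Sum>i<k. (x i)\<^sup>2) \<le> 1" "(\<Sum>i<k. (y i)\<^sup>2) \<le> 1"
  shows "(\<Sum>i<k. ((1 - t) * x i + t * y i)\<^sup>2) \<le> 1"
proof -
  have "((1 - t) * a + t * b)\<^sup>2 \<le> (1 - t) * a\<^sup>2 + t * b\<^sup>2" for a b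
  proof -
    have "(1 - t) * a\<^sup>2 + t * b\<^sup>2 - ((1 - t) * a + t * b)\<^sup>2 = t * (1 - t) * (a - b)\<^sup>2"
      by (simp add: power2_eq_square algebra_simps)
    then show ?thesis using assms(1,2) by (smt (verit) mult_nonneg_nonneg zero_le_power2)
  qed
  then have "(\<Sum>i<k. ((1 - t) * x i + t * y i)\<^sup>2) \<le> (\<Sum>i<k. (1 - t) * (x i)\<^sup>2 + t * (y i)\<^sup>2)"
    by (intro sum_mono)
  also have "\<dots> = (1 - t) * (\<Sum>i<k. (x i)\<^sup>2) + t * (\<Sum>i<k. (y i)\<^sup>2)"
    by (simp add: sum.distrib sum_distrib_left)
  also have "\<dots> \<le> (1 - t) * 1 + t * 1"
    using assms by (intro add_mono mult_left_mono) auto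
  finally show ?thesis by simp
qed

text \<open>The ray from \<open>p\<close> through \<open>x\<close> leaves the ball at \<open>p + \<tau> (x - p)\<close>, where \<open>\<tau>\<close> is the nonnegative root
  of \<open>D \<tau>\<^sup>2 + 2 E \<tau> - C = 0\<close>. This also works for \<open>p\<close> on the boundary sphere, where \<open>C = 0\<close>.\<close>

lemma ball_radial_deformation:
  assumes p: "p \<in> topspace (closed_ball k)"
  obtains h :: "real \<times> (nat \<Rightarrow> real) \<Rightarrow> nat \<Rightarrow> real" where
    "continuous_map (prod_topology (top_of_set {0..1}) (subtopology (closed_ball k) (topspace (closed_ball k) - {p})))
       (subtopology (closed_ball k) (topspace (closed_ball k) - {p})) h"
    "\<And>x. x \<in> topspace (closed_ball k) - {p} \<Longrightarrow> h (0, x) = x"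
    "\<And>x. x \<in> topspace (closed_ball k) - {p} \<Longrightarrow> h (1, x) \<in> bsphere k"
    "\<And>t x. x \<in> bsphere k - {p} \<Longrightarrow> h (t, x) = x"
proof -
  let ?B = "topspace (closed_ball k)"
  define C where "C = 1 - (\<Sum>i<k. (p i)\<^sup>2)"
  define D where "D x = (\<Sum>i<k. (x i - p i)\<^sup>2)" for x :: "nat \<Rightarrow> real"
  define E where "E x = (\<Sum>i<k. p i * (x i - p i))" for x :: "nat \<Rightarrow> real"
  define \<tau> where "\<tau> x = (sqrt ((E x)\<^sup>2 + C * D x) - E x) / D x" for x
  define h where "h z = (\<lambda>i. p i + ((1 - fst z) + fst z * \<tau> (snd z)) * (snd z i - p i))"
    for z :: "real \<times> (nat \<Rightarrow> real)"
  have C: "C \<ge> 0" using p by (simp add: C_def topspace_closed_ball)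
  have norm: "(\<Sum>i<k. (p i + s * (x i - p i))\<^sup>2) = 1 - C + 2 * s * E x + s\<^sup>2 * D x" for s x
  proof -
    have "(\<Sum>i<k. (p i + s * (x i - p i))\<^sup>2) =
        (\<Sum>i<k. (p i)\<^sup>2 + 2 * s * (p i * (x i - p i)) + s\<^sup>2 * (x i - p i)\<^sup>2)"
      by (intro sum.cong) (auto simp: power2_eq_square algebra_simps)
    then show ?thesis
      by (simp add: C_def D_def E_def sum.distrib sum_distrib_left)
  qed
  have norm1: "(\<Sum>i<k. (x i)\<^sup>2) = 1 - C + 2 * E x + D x" for x
    using norm[of 1 x] by simp
  have D: "D x > 0" if "x \<in> ?B - {p}" for x
  proof (rule ccontr)
    assume "\<not> D x > 0"
    then have "D x = 0" unfolding D_def by (meson not_less order_antisym sum_nonneg zero_le_power2)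
    then have "\<forall>i<k. x i = p i" unfolding D_def by (subst (asm) sum_nonneg_eq_0_iff) auto
    moreover have "x i = p i" if "\<not> i < k" for i
      using that \<open>x \<in> ?B - {p}\<close> p by (simp add: topspace_closed_ball)
    ultimately have "x = p" by (intro ext) blast
    then show False using that by simp
  qed
  have tau1: "\<tau> x \<ge> 1" if x: "x \<in> ?B - {p}" for x
  proof -
    have "(D x + E x)\<^sup>2 \<le> (E x)\<^sup>2 + C * D x"
    proof -
      have "2 * E x + D x \<le> C" using x norm1[of x] by (simp add: topspace_closed_ball)
      then have "(2 * E x + D x) * D x \<le> C * D x" using D[OF x] by (intro mult_right_mono) auto
      then show ?thesis by (simp add: power2_eq_square algebra_simps)
    qed
    then have "D x + E x \<le> sqrt ((E x)\<^sup>2 + C * D x)" by (rule real_le_rsqrt)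
    then show ?thesis using D[OF x] by (simp add: \<tau>_def field_simps)
  qed
  have on_sphere: "(\<Sum>i<k. (p i + \<tau> x * (x i - p i))\<^sup>2) = 1" if x: "x \<in> ?B - {p}" for x
  proof -
    have "(E x)\<^sup>2 + C * D x \<ge> 0" using C D[OF x] by simp
    then have "(\<tau> x * D x + E x)\<^sup>2 = (E x)\<^sup>2 + C * D x" using D[OF x] by (simp add: \<tau>_def)
    then have "D x * (2 * \<tau> x * E x + (\<tau> x)\<^sup>2 * D x) = D x * C"
      by (simp add: power2_eq_square algebra_simps)
    then show ?thesis using D[OF x] unfolding norm by simp
  qed
  have tau_sphere: "\<tau> x = 1" if x: "x \<in> bsphere k - {p}" for x
  proof -
    have x': "x \<in> ?B - {p}" using x by (simp add: bsphere_def)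
    have c: "C = 2 * E x + D x" using x norm1[of x] by (simp add: bsphere_eq)
    have "(E x)\<^sup>2 + C * D x = (D x + E x)\<^sup>2" by (simp add: c power2_eq_square algebra_simps)
    moreover have "D x + E x \<ge> 0" using c C D[OF x'] by linarith
    ultimately show ?thesis using D[OF x'] by (simp add: \<tau>_def)
  qed
  \<comment> \<open>The point slides along the ray from \<open>x\<close> to the exit point, hence
    stays in the ball by convexity. As \<open>\<tau> x \<ge> 1\<close>, the factor in front of
    \<open>x - p\<close> never drops below 1, so \<open>p\<close> is not reached.\<close>
  have in_ball: "h (t, x) \<in> ?B - {p}" if x: "x \<in> ?B - {p}" and t: "t \<in> {0..1}" for t x
  proof -
    have "1 \<le> (1 - t) + t * \<tau> x" using tau1[OF x] t by (simp add: algebra_simps mult_le_cancel_left1)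
    moreover obtain i where "x i \<noteq> p i" using x by (auto simp: fun_eq_iff)
    ultimately have "h (t, x) i \<noteq> p i" by (auto simp: h_def)
    then have "h (t, x) \<noteq> p" by metis
    moreover have "(\<Sum>i<k. ((1 - t) * x i + t * (p i + \<tau> x * (x i - p i)))\<^sup>2) \<le> 1"
      using x t on_sphere[OF x] by (intro sum_square_convex) (auto simp: topspace_closed_ball)
    then have "(\<Sum>i<k. (h (t, x) i)\<^sup>2) \<le> 1"
      by (simp add: h_def algebra_simps)
    moreover have "\<forall>i\<ge>k. h (t, x) i = 0" using x p by (auto simp: h_def topspace_closed_ball)
    ultimately show ?thesis by (auto simp: topspace_closed_ball)
  qed
  have top: "subtopology (closed_ball k) (?B - {p}) = top_of_set (?B - {p})"
    by (subst closed_ball_top_of_set) (simp add: subtopology_subtopology Int_absorb1)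
  have D0: "(\<Sum>i<k. (snd z i - p i)\<^sup>2) \<noteq> 0" if "z \<in> {0..1::real} \<times> (?B - {p})" for z
    using that D[of "snd z"] by (auto simp: D_def)
  have "continuous_on ({0..1} \<times> (?B - {p})) h"
  proof (rule continuous_on_coordinatewise_then_product)
    fix i
    show "continuous_on ({0..1} \<times> (?B - {p})) (\<lambda>z. h z i)"
      unfolding h_def \<tau>_def D_def E_def
      by (intro continuous_intros continuous_on_snd_coordinate ballI D0)
  qed
  then have "continuous_map (prod_topology (top_of_set {0..1}) (subtopology (closed_ball k) (?B - {p})))
       (subtopology (closed_ball k) (?B - {p})) h"
  proof -
    have "h \<in> ({0..1} \<times> (?B - {p})) \<rightarrow> ?B - {p}"
      by (intro Pi_I) (metis SigmaE in_ball)
    with \<open>continuous_on _ h\<close> show ?thesis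
      unfolding top by (simp flip: subtopology_Times)
  qed
  moreover have "h (0, x) = x" for x by (simp add: h_def)
  moreover have "h (1, x) \<in> bsphere k" if "x \<in> ?B - {p}" for x
    using that on_sphere[OF that] p by (auto simp: h_def bsphere_eq topspace_closed_ball)
  moreover have "h (t, x) = x" if "x \<in> bsphere k - {p}" for t x
    using tau_sphere[OF that] by (simp add: h_def)
  ultimately show ?thesis using that by blast
qed

text \<open>Scaling towards the centre moves every point into the open ball at once, so any set of
  boundary points may be missing. It serves for \<open>P\<close> empty, a single point, and the
  whole sphere, which leaves the open ball.\<close>

lemma contractible_star_ball:
  assumes P: "P \<subseteq> bsphere k"
  shows "contractible_space (subtopology (closed_ball k) (topspace (closed_ball k) - P))"
proof -
  let ?B = "topspace (closed_ball k)"
  have top: "subtopology (closed_ball k) (?B - P) = top_of_set (?B - P)"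
    by (subst closed_ball_top_of_set) (simp add: subtopology_subtopology Int_absorb1)
  define h where "h z = (\<lambda>i. (1 - fst z) * snd z i)" for z :: "real \<times> (nat \<Rightarrow> real)"
  have "continuous_on ({0..1} \<times> (?B - P)) h"
  proof (rule continuous_on_coordinatewise_then_product)
    fix i
    show "continuous_on ({0..1} \<times> (?B - P)) (\<lambda>z. h z i)"
      unfolding h_def by (intro continuous_intros continuous_on_snd_coordinate)
  qed
  moreover have "h (t, x) \<in> ?B - P" if x: "x \<in> ?B - P" and t: "t \<in> {0..1}" for t x
  proof (cases "t = 0")
    case True
    then show ?thesis using x by (simp add: h_def)
  next
    case False
    have "(\<Sum>i<k. (h (t, x) i)\<^sup>2) = (1 - t)\<^sup>2 * (\<Sum>i<k. (x i)\<^sup>2)"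
      by (simp add: h_def power_mult_distrib sum_distrib_left)
    also have "\<dots> \<le> (1 - t)\<^sup>2 * 1"
      using x by (intro mult_left_mono) (auto simp: topspace_closed_ball)
    also have "\<dots> < 1" using False t by (simp add: power_less_one_iff abs_if)
    finally have "h (t, x) \<in> open_ball k" using x by (auto simp: open_ball_eq h_def topspace_closed_ball)
    then show ?thesis using P open_ball_subset by (auto simp: bsphere_def)
  qed
  ultimately have "homotopic_with (\<lambda>_. True) (top_of_set (?B - P)) (top_of_set (?B - P)) id (\<lambda>x i. 0)"
    unfolding homotopic_with_def
    by (intro exI[of _ h]) (auto simp: h_def simp flip: subtopology_Times)
  then show ?thesis
    unfolding top contractible_space_def by blast
qed

text \<open>\<open>Y\<close> is the union of \<open>A\<close> and a closed \<open>k\<close>-ball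
  glued along its boundary, described inside \<open>Y\<close>. Nothing is said about cells of
  \<open>A\<close>, so \<open>A\<close> may have lost a point. For \<open>k = 0\<close> the gluing
  set is empty.\<close>

definition attaches :: "'a topology \<Rightarrow> 'a set \<Rightarrow> 'a set \<Rightarrow> nat \<Rightarrow> ((nat \<Rightarrow> real) \<Rightarrow> 'a) \<Rightarrow> bool"
  where "attaches Y A C k f \<longleftrightarrow> closedin Y A \<and> closedin Y C \<and>
    homeomorphic_map (closed_ball k) (subtopology Y C) f \<and>
    A \<union> C = topspace Y \<and> A \<inter> C = f ` bsphere k"

lemma continuous_map_on_two_closed:
  assumes "closedin X S" "closedin X T" "S \<union> T = topspace X"
    and "continuous_map (subtopology X S) Y f" "continuous_map (subtopology X T) Y g"
    and "\<And>x. x \<in> S \<Longrightarrow> h x = f x" "\<And>x. x \<in> T \<Longrightarrow> h x = g x"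
  shows "continuous_map X Y h"
proof (rule pasting_lemma_closed[where I = "UNIV :: bool set" and T = "\<lambda>b. if b then S else T"
      and f = "\<lambda>b. if b then f else g"])
  show "(if i then f else g) x = (if j then f else g) x"
    if "x \<in> topspace X \<inter> (if i then S else T) \<inter> (if j then S else T)" for i j x
    using that assms(6,7)[of x] by (auto split: if_splits)
  show "\<exists>j. j \<in> UNIV \<and> x \<in> (if j then S else T) \<and> h x = (if j then f else g) x" if "x \<in> topspace X" for x
    using that assms(3,6,7) by (metis UNIV_I UnE)
qed (use assms in auto)

text \<open>The radial deformation of the cell away from \<open>p\<close> fixes the attaching sphere
  and so extends by the identity over \<open>A\<close>. The point may lie in the open cell or on its
  boundary; in the latter case \<open>A\<close> is punctured as well.\<close>

lemma attaches_deformation: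
  assumes at: "attaches Y A C k f" and p: "p \<in> C"
  shows "trivial_group (relative_homology_group q (subtopology Y (topspace Y - {p})) (A - {p}))"
proof -
  let ?B = "topspace (closed_ball k)"
  let ?Z = "subtopology Y (topspace Y - {p})"
  let ?I = "top_of_set {0..1::real}"
  have A: "closedin Y A" "closedin Y C" "homeomorphic_map (closed_ball k) (subtopology Y C) f"
    "A \<union> C = topspace Y" "A \<inter> C = f ` bsphere k"
    using at by (auto simp: attaches_def)
  have sub: "A \<subseteq> topspace Y" "C \<subseteq> topspace Y" using A by auto
  obtain g where fg: "homeomorphic_maps (closed_ball k) (subtopology Y C) f g"
    using A(3) homeomorphic_map_maps by blast
  have cf: "continuous_map (closed_ball k) (subtopology Y C) f" and cg: "continuous_map (subtopology Y C) (closed_ball k) g"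
    and gf: "\<And>x. x \<in> ?B \<Longrightarrow> g (f x) = x" and fgx: "\<And>x. x \<in> C \<Longrightarrow> f (g x) = x"
    using fg sub by (auto simp: homeomorphic_maps_def)
  have gB: "g x \<in> ?B" if "x \<in> C" for x
    using that cg sub(2) by (auto simp: continuous_map_def Pi_iff)
  have fC: "f x \<in> C" if "x \<in> ?B" for x
    using that cf by (auto simp: continuous_map_def Pi_iff)
  have gp: "g x \<noteq> g p" if "x \<in> C" "x \<noteq> p" for x
    using that p fgx by metis
  have gsph: "g x \<in> bsphere k" if "x \<in> A" "x \<in> C" for x
  proof -
    have "x \<in> f ` bsphere k" using that A(5) by blast
    then show ?thesis using gf by (auto simp: bsphere_def)
  qed
  obtain h where h: "continuous_map (prod_topology ?I (subtopology (closed_ball k) (?B - {g p})))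
       (subtopology (closed_ball k) (?B - {g p})) h"
    "\<And>x. x \<in> ?B - {g p} \<Longrightarrow> h (0, x) = x"
    "\<And>x. x \<in> ?B - {g p} \<Longrightarrow> h (1, x) \<in> bsphere k"
    "\<And>t x. x \<in> bsphere k - {g p} \<Longrightarrow> h (t, x) = x"
    using ball_radial_deformation[OF gB[OF p]] by blast
  have hB: "h (t, x) \<in> ?B - {g p}" if "t \<in> {0..1}" "x \<in> ?B - {g p}" for t x
  proof -
    have "(t, x) \<in> topspace (prod_topology ?I (subtopology (closed_ball k) (?B - {g p})))"
      using that by simp
    with h(1) show ?thesis by (force simp: continuous_map_def Pi_iff)
  qed
  \<comment> \<open>Where \<open>A\<close> meets the cell both branches agree, because the
    deformation fixes the sphere pointwise. This permits pasting along the two closed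
    pieces.\<close>
  define r where "r z = (if snd z \<in> A then snd z else f (h (fst z, g (snd z))))" for z
  have rC: "r z = f (h (fst z, g (snd z)))" if "snd z \<in> C - {p}" for z
    using that gsph[of "snd z"] gp[of "snd z"] h(4)[of "g (snd z)" "fst z"] fgx by (auto simp: r_def)
  have cont: "continuous_map (prod_topology ?I ?Z) ?Z r"
  proof (rule continuous_map_on_two_closed[where S = "{0..1} \<times> (A - {p})" and T = "{0..1} \<times> (C - {p})"
        and f = snd and g = "\<lambda>z. f (h (fst z, g (snd z)))"])
    have "closedin ?Z (topspace ?Z \<inter> A)" "closedin ?Z (topspace ?Z \<inter> C)"
      using A(1,2) by (auto simp: closedin_subtopology)
    moreover have "topspace ?Z \<inter> A = A - {p}" "topspace ?Z \<inter> C = C - {p}" using sub by auto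
    ultimately have c: "closedin ?Z (A - {p})" "closedin ?Z (C - {p})" by auto
    then show "closedin (prod_topology ?I ?Z) ({0..1} \<times> (A - {p}))"
      "closedin (prod_topology ?I ?Z) ({0..1} \<times> (C - {p}))"
      by (auto simp: closedin_prod_Times_iff)
    show "{0..1} \<times> (A - {p}) \<union> {0..1} \<times> (C - {p}) = topspace (prod_topology ?I ?Z)"
      using A(4) sub by auto
    show "continuous_map (subtopology (prod_topology ?I ?Z) ({0..1} \<times> (A - {p}))) ?Z snd"
      by (intro continuous_map_from_subtopology continuous_map_snd)
    have eq: "subtopology (prod_topology ?I ?Z) ({0..1} \<times> (C - {p})) =
        prod_topology ?I (subtopology Y (C - {p}))"
      using sub by (simp add: subtopology_Times subtopology_subtopology Int_absorb1 inf.absorb2 Diff_mono)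
    have "continuous_map (subtopology Y (C - {p})) (closed_ball k) g"
      using continuous_map_from_subtopology[OF cg, of "C - {p}"]
      by (simp add: subtopology_subtopology inf.absorb2)
    then have g1: "continuous_map (subtopology Y (C - {p})) (subtopology (closed_ball k) (?B - {g p})) g"
      using gB gp by (auto simp: continuous_map_in_subtopology)
    have "continuous_map (prod_topology ?I (subtopology Y (C - {p})))
        (prod_topology ?I (subtopology (closed_ball k) (?B - {g p}))) (\<lambda>z. (fst z, g (snd z)))"
      by (intro continuous_map_paired[THEN iffD2] conjI continuous_map_fst
          continuous_map_compose[OF continuous_map_snd g1, unfolded o_def])
    from continuous_map_compose[OF this h(1)]
    have 2: "continuous_map (prod_topology ?I (subtopology Y (C - {p})))
        (subtopology (closed_ball k) (?B - {g p})) (\<lambda>z. h (fst z, g (snd z)))"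
      by (simp add: o_def)
    have "continuous_map (closed_ball k) Y f"
      using cf continuous_map_in_subtopology by blast
    then have "continuous_map (subtopology (closed_ball k) (?B - {g p})) Y f"
      by (rule continuous_map_from_subtopology)
    moreover have "f x \<in> topspace Y - {p}" if "x \<in> ?B - {g p}" for x
      using that fC[of x] gf[of x] sub by auto
    ultimately have "continuous_map (subtopology (closed_ball k) (?B - {g p})) ?Z f"
      by (auto simp: continuous_map_in_subtopology)
    from continuous_map_compose[OF 2 this]
    show "continuous_map (subtopology (prod_topology ?I ?Z) ({0..1} \<times> (C - {p}))) ?Z
        (\<lambda>z. f (h (fst z, g (snd z))))"
      unfolding eq by (simp add: o_def)
    show "r z = snd z" if "z \<in> {0..1} \<times> (A - {p})" for z using that by (auto simp: r_def)
    show "r z = f (h (fst z, g (snd z)))" if "z \<in> {0..1} \<times> (C - {p})" for z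
      by (rule rC) (use that in auto)
  qed
  have r0: "r (0, x) = x" if "x \<in> topspace ?Z" for x
    using that A(4) h(2)[of "g x"] gB[of x] gp[of x] fgx[of x] by (auto simp: r_def)
  have r1: "r (1, x) \<in> A - {p}" if "x \<in> topspace ?Z" for x
  proof (cases "x \<in> A")
    case True
    then show ?thesis using that by (simp add: r_def)
  next
    case False
    then have x: "x \<in> C" "x \<noteq> p" using that A(4) by auto
    then have "h (1, g x) \<in> bsphere k" "h (1, g x) \<noteq> g p"
      using h(3)[of "g x"] hB[of 1 "g x"] gB gp by auto
    then have "f (h (1, g x)) \<in> A" "f (h (1, g x)) \<noteq> p"
      using A(5) gf[of "h (1, g x)"] by (auto simp: bsphere_def)
    then show ?thesis using False by (simp add: r_def)
  qed
  have cont1: "continuous_map ?Z ?Z (\<lambda>x. r (1, x))"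
    using continuous_map_compose[OF _ cont, of ?Z "\<lambda>x. (1, x)"]
    by (auto simp: o_def continuous_map_paired)
  show ?thesis
  proof (rule trivial_relative_homology_group_alt)
    show "continuous_map ?Z (subtopology ?Z (A - {p})) (\<lambda>x. r (1, x))"
      using cont1 r1 by (auto simp: continuous_map_in_subtopology)
    have "homotopic_with (\<lambda>k. k ` (A - {p}) \<subseteq> A - {p}) ?Z ?Z id (\<lambda>x. r (1, x))"
    proof (rule homotopic_with[THEN iffD2, rule_format])
      show "\<exists>h. continuous_map (prod_topology ?I ?Z) ?Z h \<and>
          (\<forall>x\<in>topspace ?Z. h (0, x) = id x) \<and> (\<forall>x\<in>topspace ?Z. h (1, x) = r (1, x)) \<and>
          (\<forall>t\<in>{0..1}. (\<lambda>x. h (t, x)) ` (A - {p}) \<subseteq> A - {p})"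
        using cont r0 by (intro exI[of _ r]) (auto simp: r_def)
    next
      fix h k :: "'a \<Rightarrow> 'a"
      assume "\<And>x. x \<in> topspace ?Z \<Longrightarrow> h x = k x"
      then have "h x = k x" if "x \<in> A - {p}" for x using that sub by auto
      then show "(h ` (A - {p}) \<subseteq> A - {p}) = (k ` (A - {p}) \<subseteq> A - {p})"
        by (metis image_cong)
    qed
    then show "homotopic_with (\<lambda>k. k ` (A - {p}) \<subseteq> A - {p}) ?Z ?Z (\<lambda>x. r (1, x)) id"
      by (simp add: homotopic_with_sym)
  qed
qed

lemma has_euler_deformation:
  assumes at: "attaches Y A C k f" and p: "p \<in> C" and a: "has_euler (subtopology Y (A - {p})) {} a"
  shows "has_euler (subtopology Y (topspace Y - {p})) {} a"
proof -
  let ?Z = "subtopology Y (topspace Y - {p})"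
  have "A - {p} \<subseteq> topspace Y - {p}" using at by (auto simp: attaches_def)
  then have "has_euler (subtopology ?Z (A - {p})) {} a"
    using a by (simp add: subtopology_subtopology inf.absorb2)
  moreover have "has_euler ?Z (A - {p}) 0"
    by (intro has_euler_trivial attaches_deformation[OF at p])
  ultimately show ?thesis using has_euler_absolute by fastforce
qed

section \<open>Contribution of one attached cell\<close>

lemma attaches_cell_center:
  assumes "attaches Y A C k f"
  shows "f (\<lambda>_. 0) \<in> C" "f (\<lambda>_. 0) \<notin> A" "closedin Y {f (\<lambda>_. 0)}" "f ` open_ball k = topspace Y - A"
proof -
  let ?B = "topspace (closed_ball k)" and ?o = "\<lambda>_::nat. 0::real"
  have A: "closedin Y A" "closedin Y C" "homeomorphic_map (closed_ball k) (subtopology Y C) f"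
    "A \<union> C = topspace Y" "A \<inter> C = f ` bsphere k"
    using assms by (auto simp: attaches_def)
  have fB: "f ` ?B = C" and inj: "inj_on f ?B"
    using homeomorphic_imp_surjective_map[OF A(3)] homeomorphic_imp_injective_map[OF A(3)] closedin_subset[OF A(2)]
    by auto
  have "f ` open_ball k = f ` ?B - f ` bsphere k"
    using inj open_ball_subset[of k] by (simp add: inj_on_image_set_diff[OF inj, symmetric] bsphere_def double_diff)
  then show e: "f ` open_ball k = topspace Y - A"
    using fB A(4,5) by auto
  then show "f ?o \<in> C" "f ?o \<notin> A"
    using zero_in_open_ball[of k] A(4) by blast+
  have "closedin (closed_ball k) {?o}"
    using Hausdorff_closed_ball zero_in_open_ball open_ball_subset
    by (intro closedin_Hausdorff_singleton) blast+
  then have "closedin (subtopology Y C) (f ` {?o})"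
    using homeomorphic_imp_closed_map[OF A(3)] by (auto simp: closed_map_def)
  then show "closedin Y {f ?o}"
    using A(2) closedin_trans_full by auto
qed

text \<open>Cutting out \<open>A\<close> leaves the open cell, so the relative homology at the cell
  centre depends on \<open>k\<close> alone. Excision applies since the centre is a closed point
  outside \<open>A\<close>.\<close>

lemma attaches_excision:
  assumes at: "attaches Y A C k f"
  shows "relative_homology_group q (subtopology (closed_ball k) (open_ball k)) (open_ball k - {\<lambda>_. 0}) \<cong>
    relative_homology_group q Y (topspace Y - {f (\<lambda>_. 0)})"
proof -
  let ?B = "topspace (closed_ball k)" and ?o = "\<lambda>_::nat. 0::real"
  let ?c = "f ?o" and ?e = "f ` open_ball k"
  have A: "closedin Y A" "closedin Y C" "homeomorphic_map (closed_ball k) (subtopology Y C) f"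
    "A \<union> C = topspace Y" "A \<inter> C = f ` bsphere k"
    using at by (auto simp: attaches_def)
  note c = attaches_cell_center[OF at]
  have fB: "f ` ?B = C" and inj: "inj_on f ?B"
    using homeomorphic_imp_surjective_map[OF A(3)] homeomorphic_imp_injective_map[OF A(3)] closedin_subset[OF A(2)]
    by auto
  have eC: "?e \<subseteq> C" using fB open_ball_subset[of k] by blast
  have "homeomorphic_map (subtopology (closed_ball k) (open_ball k)) (subtopology (subtopology Y C) ?e) f"
    by (rule homeomorphic_map_subtopologies[OF A(3)])
      (use eC A(4) open_ball_subset[of k] in \<open>simp add: inf.absorb2 le_supI2 flip: A(4)\<close>)
  then have hom: "homeomorphic_map (subtopology (closed_ball k) (open_ball k)) (subtopology Y ?e) f"
    using eC by (simp add: subtopology_subtopology inf.absorb2)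
  have im: "f ` (open_ball k - {?o}) = ?e - {?c}"
    using inj_on_image_set_diff[OF inj, of "open_ball k" "{?o}"] open_ball_subset[of k] zero_in_open_ball[of k] by auto
  have 1: "relative_homology_group q (subtopology (closed_ball k) (open_ball k)) (open_ball k - {?o}) \<cong>
     relative_homology_group q (subtopology Y ?e) (?e - {?c})"
    using homeomorphic_map_relative_homology_iso[OF hom _ im] open_ball_subset[of k] is_isoI
    by (metis Diff_subset Int_absorb1 topspace_subtopology)
  have "openin Y (topspace Y - {?c})" using c(3) by blast
  then have "Y closure_of A \<subseteq> Y interior_of (topspace Y - {?c})"
    using A(1) c(2) closedin_subset[OF A(1)] by (simp add: closure_of_closedin interior_of_openin) blast
  from homology_excision_axiom[OF this, of "topspace Y" q]
  have "relative_homology_group q (subtopology Y (topspace Y - A)) (topspace Y - {?c} - A) \<cong>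
      relative_homology_group q Y (topspace Y - {?c})"
    by (auto intro: is_isoI)
  moreover have "topspace Y - {?c} - A = ?e - {?c}" using c(4) by auto
  ultimately have "relative_homology_group q (subtopology Y ?e) (?e - {?c}) \<cong>
      relative_homology_group q Y (topspace Y - {?c})"
    using c(4) by simp
  then show ?thesis using 1 iso_trans by blast
qed

text \<open>The ball is attached to its own boundary sphere, which makes the statements about
  attached cells available for the model cell.\<close>

lemma attaches_closed_ball: "attaches (closed_ball k) (bsphere k) (topspace (closed_ball k)) k id"
proof -
  have "closedin (closed_ball k) (bsphere k)"
    unfolding bsphere_def
    using openin_open_ball[of k] open_ball_subset[of k]
    by (intro closedin_diff closedin_topspace) (auto simp: closed_ball_def openin_subtopology closedin_def)
  then show ?thesis
    by (auto simp: attaches_def bsphere_def)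
qed

lemma has_euler_bsphere: "has_euler (subtopology (closed_ball k) (bsphere k)) {} (1 - (-1) ^ k)"
proof (cases k)
  case 0
  have "topspace (subtopology (closed_ball k) (bsphere k)) = {}"
    using 0 by (auto simp: bsphere_eq)
  then have "has_euler (subtopology (closed_ball k) (bsphere k)) {} 0"
    by (intro has_euler_trivial trivial_relative_homology_group_empty)
  then show ?thesis using 0 by simp
next
  case (Suc m)
  have "topspace (Euclidean_space k) \<inter> ({x. (\<Sum>i<k. (x i)\<^sup>2) \<le> 1} \<inter> bsphere k) =
      topspace (Euclidean_space k) \<inter> {x. (\<Sum>i\<le>m. (x i)\<^sup>2) = 1}"
    unfolding Suc by (auto simp: bsphere_eq topspace_Euclidean_space lessThan_Suc_atMost)
  then have "subtopology (closed_ball k) (bsphere k) = nsphere m"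
    unfolding nsphere_def closed_ball_def subtopology_subtopology Suc
    by (metis subtopology_restrict)
  then show ?thesis using has_euler_nsphere[of m] Suc by simp
qed

text \<open>In the model, the ball has value 1 and the ball without its centre the value
  \<open>1 - (-1) ^ k\<close> of its boundary sphere. Both the model and \<open>Y\<close> excise to
  the open ball, which carries the difference over to \<open>Y\<close>.\<close>

lemma has_euler_punctured_cell:
  assumes at: "attaches Y A C k f"
  shows "has_euler Y (topspace Y - {f (\<lambda>_. 0)}) ((-1) ^ k)"
proof -
  let ?B = "topspace (closed_ball k)" and ?o = "\<lambda>_::nat. 0::real"
  have 0: "?o \<in> ?B" "?o \<notin> bsphere k"
    using zero_in_open_ball[of k] open_ball_subset[of k] by (auto simp: bsphere_def)
  have "has_euler (subtopology (closed_ball k) (?B - {?o})) {} (1 - (-1) ^ k)"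
    by (rule has_euler_deformation[OF attaches_closed_ball]) (use 0 has_euler_bsphere in auto)
  moreover have "has_euler (closed_ball k) {} 1"
    using contractible_star_ball[of "{}" k] 0 by (intro has_euler_contractible) auto
  ultimately have "has_euler (closed_ball k) (?B - {?o}) ((-1) ^ k)"
    using has_euler_relative by fastforce
  moreover have "relative_homology_group q (closed_ball k) (?B - {?o}) \<cong>
      relative_homology_group q Y (topspace Y - {f ?o})" for q
    using iso_trans[OF group.iso_sym[OF group_relative_homology_group attaches_excision[OF attaches_closed_ball]]
        attaches_excision[OF at], of q] by simp
  ultimately show ?thesis by (rule has_euler_iso)
qed

text \<open>Without the cell centre \<open>Y\<close> deforms onto \<open>A\<close>; putting the
  centre back adds the relative value.\<close>

lemma has_euler_attach:
  assumes at: "attaches Y A C k f" and a: "has_euler (subtopology Y A) {} a"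
  shows "has_euler Y {} (a + (-1) ^ k)"
proof (rule has_euler_absolute[OF _ has_euler_punctured_cell[OF at]])
  show "has_euler (subtopology Y (topspace Y - {f (\<lambda>_. 0)})) {} a"
    by (rule has_euler_deformation[OF at]) (use a attaches_cell_center[OF at] in auto)
qed

section \<open>Euler characteristics of regular CW decompositions\<close>

text \<open>All cells of smaller dimension are included, not only those in boundaries of members.
  The CW condition controls boundaries by dimension alone, so this form yields closed unions before
  closed cells are known to be unions of cells.\<close>

definition dim_closed :: "'a topology \<Rightarrow> 'a set set \<Rightarrow> 'a set set \<Rightarrow> bool"
  where "dim_closed X K M \<longleftrightarrow> M \<subseteq> K \<and> (\<forall>e\<in>M. \<forall>c\<in>K. cell_dim X c < cell_dim X e \<longrightarrow> c \<in> M)"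

lemma finite_maximal_cell:
  assumes "finite M" "M \<noteq> {}"
  shows "\<exists>e\<in>M. \<forall>c\<in>M. cell_dim X c \<le> cell_dim X e"
proof -
  have "Max (cell_dim X ` M) \<in> cell_dim X ` M" using assms by simp
  then show ?thesis using Max_ge[of "cell_dim X ` M"] assms(1) by force
qed

context
  fixes X :: "'a topology" and K :: "'a set set"
  assumes CW: "regular_CW X K"
begin

lemma CW_cell:
  assumes "e \<in> K"
  obtains f where "homeomorphic_map (closed_ball (cell_dim X e)) (subtopology X (X closure_of e)) f"
    "f ` open_ball (cell_dim X e) = e" "f ` topspace (closed_ball (cell_dim X e)) = X closure_of e"
    "f ` bsphere (cell_dim X e) = X closure_of e - e"
proof -
  obtain k where "regular_cell X k e" using CW assms by (auto simp: regular_CW_def)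
  then have "regular_cell X (cell_dim X e) e" using cell_dim_eq by metis
  then obtain f where f: "homeomorphic_map (closed_ball (cell_dim X e)) (subtopology X (X closure_of e)) f"
    "f ` open_ball (cell_dim X e) = e"
    by (auto simp: regular_cell_def)
  have im: "f ` topspace (closed_ball (cell_dim X e)) = X closure_of e"
    using homeomorphic_imp_surjective_map[OF f(1)] closure_of_subset_topspace[of X e] by auto
  moreover have "f ` bsphere (cell_dim X e) = X closure_of e - e"
    unfolding bsphere_def
    using inj_on_image_set_diff[OF homeomorphic_imp_injective_map[OF f(1)], of _ "open_ball (cell_dim X e)"]
      open_ball_subset im f(2) by auto
  ultimately show ?thesis using that f by blast
qed

lemma CW_subset_closure: "e \<in> K \<Longrightarrow> e \<subseteq> X closure_of e"
  using CW_cell by (metis image_mono open_ball_subset)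

lemma CW_closure_minus: "e \<in> K \<Longrightarrow> X closure_of e - e \<subseteq> \<Union>{c \<in> K. cell_dim X c < cell_dim X e}"
  using CW by (auto simp: regular_CW_def)

lemma CW_disjoint: "c \<in> K \<Longrightarrow> e \<in> K \<Longrightarrow> x \<in> c \<Longrightarrow> x \<in> e \<Longrightarrow> c = e"
  using CW by (auto simp: regular_CW_def dest: disjointD)

lemma CW_finite: "finite K"
  using CW by (simp add: regular_CW_def)

lemma CW_Union: "\<Union>K = topspace X"
  using CW by (simp add: regular_CW_def)

lemma CW_nonempty: "e \<in> K \<Longrightarrow> e \<noteq> {}"
  using CW regular_cell_nonempty by (fastforce simp: regular_CW_def)

lemma CW_closed_Union:
  assumes "dim_closed X K M"
  shows "closedin X (\<Union>M)"
proof -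
  have M: "M \<subseteq> K" "\<And>e c. e \<in> M \<Longrightarrow> c \<in> K \<Longrightarrow> cell_dim X c < cell_dim X e \<Longrightarrow> c \<in> M"
    using assms by (auto simp: dim_closed_def)
  have "X closure_of e \<subseteq> \<Union>M" if "e \<in> M" for e
  proof -
    have "X closure_of e - e \<subseteq> \<Union>M" using CW_closure_minus[of e] M that by blast
    then show ?thesis using that by blast
  qed
  moreover have "e \<subseteq> X closure_of e" if "e \<in> M" for e
    using CW_subset_closure M(1) that by blast
  ultimately have "\<Union>M = \<Union>((closure_of) X ` M)" by blast
  moreover have "closedin X (\<Union>((closure_of) X ` M))"
    using finite_subset[OF M(1) CW_finite] by (intro closedin_Union) auto
  ultimately show ?thesis by simp
qed

text \<open>The boundary of \<open>e\<close> lies in cells of smaller dimension, all of which belong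
  to \<open>M - {e}\<close>. As \<open>P\<close> avoids the closed cell, that cell is still a full
  ball in the punctured space.\<close>

lemma CW_attaches:
  assumes DM: "dim_closed X K M" and M': "dim_closed X K (M - {e})"
    and e: "e \<in> M" and P: "P \<inter> X closure_of e = {}"
  obtains f where "attaches (subtopology X (\<Union>M - P)) (\<Union>(M - {e}) - P) (X closure_of e) (cell_dim X e) f"
proof -
  have M: "M \<subseteq> K" "\<And>e c. e \<in> M \<Longrightarrow> c \<in> K \<Longrightarrow> cell_dim X c < cell_dim X e \<Longrightarrow> c \<in> M"
    using DM by (auto simp: dim_closed_def)
  let ?C = "X closure_of e" and ?Y = "subtopology X (\<Union>M - P)" and ?A = "\<Union>(M - {e}) - P"
  have eK: "e \<in> K" using e M by blast
  obtain f where f: "homeomorphic_map (closed_ball (cell_dim X e)) (subtopology X ?C) f"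
    "f ` bsphere (cell_dim X e) = ?C - e"
    by (rule CW_cell[OF eK])
  have bd: "?C - e \<subseteq> \<Union>(M - {e})"
  proof
    fix x assume "x \<in> ?C - e"
    then obtain c where "c \<in> K" "cell_dim X c < cell_dim X e" "x \<in> c"
      using CW_closure_minus[OF eK] by blast
    then show "x \<in> \<Union>(M - {e})" using M(2)[OF e] by blast
  qed
  have eC: "e \<subseteq> ?C" using CW_subset_closure[OF eK] .
  have CM: "?C \<subseteq> \<Union>M - P" using bd e P by blast
  have disj: "e \<inter> \<Union>(M - {e}) = {}" using CW_disjoint M(1) e by blast
  have MX: "\<Union>M \<subseteq> topspace X" using M(1) CW_Union by blast
  have "closedin X (\<Union>(M - {e}))" using CW_closed_Union[OF M'] .
  then have "closedin ?Y (\<Union>(M - {e}) \<inter> (\<Union>M - P))" by (auto simp: closedin_subtopology)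
  moreover have "\<Union>(M - {e}) \<inter> (\<Union>M - P) = ?A" by blast
  ultimately have 1: "closedin ?Y ?A" by simp
  have 2: "closedin ?Y ?C" using CM by (auto simp: closedin_subtopology intro!: exI[of _ ?C])
  have 3: "subtopology ?Y ?C = subtopology X ?C" using CM by (simp add: subtopology_subtopology inf.absorb2)
  have "topspace ?Y = \<Union>M - P" using MX by auto
  moreover define U where "U = \<Union>(M - {e})"
  moreover have "\<Union>M = \<Union>(M - {e}) \<union> e" using e by blast
  ultimately have 4: "?A \<union> ?C = topspace ?Y"
    using CM eC P bd unfolding U_def[symmetric] by auto
  have 5: "?A \<inter> ?C = ?C - e" using bd disj P unfolding U_def[symmetric] by auto
  have "attaches ?Y ?A ?C (cell_dim X e) f"
    unfolding attaches_def using 1 2 3 4 5 f by simp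
  then show ?thesis using that by blast
qed

text \<open>Taking off a cell of maximal dimension keeps the rest \<open>dim_closed\<close>.
  Allowing \<open>P\<close> to be empty or \<open>{p}\<close> treats the whole and the punctured
  space together.\<close>

lemma CW_euler_down_closed:
  assumes "dim_closed X K M" and P: "P \<subseteq> {p}"
  shows "has_euler (subtopology X (\<Union>M - P)) {} (\<Sum>e | e \<in> M \<and> P \<inter> X closure_of e = {}. (-1) ^ cell_dim X e)"
  using assms(1)
proof (induction "card M" arbitrary: M)
  case 0
  have "finite M" using 0(2) CW_finite finite_subset unfolding dim_closed_def by blast
  then have "M = {}" using 0(1) by simp
  then show ?case by (auto intro!: has_euler_trivial trivial_relative_homology_group_empty)
next
  case (Suc N)
  have MK: "M \<subseteq> K" using Suc.prems by (simp add: dim_closed_def)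
  have fin: "finite M" using MK CW_finite finite_subset by blast
  have "M \<noteq> {}" using Suc.hyps(2) by auto
  obtain e where e: "e \<in> M" "\<And>c. c \<in> M \<Longrightarrow> cell_dim X c \<le> cell_dim X e"
    using finite_maximal_cell[OF fin \<open>M \<noteq> {}\<close>] by blast
  have down: "dim_closed X K (M - {e})"
    unfolding dim_closed_def
  proof (intro conjI ballI impI)
    show "M - {e} \<subseteq> K" using MK by blast
    fix a c assume a: "a \<in> M - {e}" and c: "c \<in> K" "cell_dim X c < cell_dim X a"
    have "c \<in> M" using Suc.prems a c by (auto simp: dim_closed_def)
    moreover have "c \<noteq> e" using e(2)[of a] a c(2) by auto
    ultimately show "c \<in> M - {e}" by simp
  qed
  have IH: "has_euler (subtopology X (\<Union>(M - {e}) - P)) {}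
      (\<Sum>c | c \<in> M - {e} \<and> P \<inter> X closure_of c = {}. (-1) ^ cell_dim X c)"
  proof (rule Suc.hyps(1))
    show "N = card (M - {e})" using Suc.hyps(2) e(1) fin by simp
  qed (rule down)
  have MX: "\<Union>M \<subseteq> topspace X" using MK CW_Union by blast
  show ?case
  proof (cases "P \<inter> X closure_of e = {}")
    case True
    obtain f where f: "attaches (subtopology X (\<Union>M - P)) (\<Union>(M - {e}) - P) (X closure_of e) (cell_dim X e) f"
      by (rule CW_attaches[OF Suc.prems down e(1) True])
    have "subtopology (subtopology X (\<Union>M - P)) (\<Union>(M - {e}) - P) = subtopology X (\<Union>(M - {e}) - P)"
      by (simp add: subtopology_subtopology) (metis Diff_mono Union_mono Diff_subset inf.absorb2 order_refl)
    with has_euler_attach[OF f] IH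
    have "has_euler (subtopology X (\<Union>M - P)) {}
        ((\<Sum>c | c \<in> M - {e} \<and> P \<inter> X closure_of c = {}. (-1) ^ cell_dim X c) + (-1) ^ cell_dim X e)"
      by simp
    moreover have "{c. c \<in> M \<and> P \<inter> X closure_of c = {}} =
        insert e {c. c \<in> M - {e} \<and> P \<inter> X closure_of c = {}}"
      using True e(1) by blast
    ultimately show ?thesis using fin by (simp add: add.commute)
  next
    case False
    then have Pp: "P = {p}" "p \<in> X closure_of e" using P by auto
    \<comment> \<open>The cell is attached in the space that still contains \<open>p\<close>; only
      the result is punctured. The deformation lemma then shows that the cell contributes
      nothing.\<close>
    obtain f where f: "attaches (subtopology X (\<Union>M - {})) (\<Union>(M - {e}) - {}) (X closure_of e) (cell_dim X e) f"
      by (rule CW_attaches[OF Suc.prems down e(1), of "{}"]) simp_all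
    have "\<Union>M \<inter> (\<Union>(M - {e}) - {p}) = \<Union>(M - {e}) - {p}" by blast
    moreover have "\<Union>M \<inter> (topspace X \<inter> \<Union>M - {p}) = \<Union>M - {p}" using MX by blast
    moreover have "{c. c \<in> M \<and> P \<inter> X closure_of c = {}} = {c. c \<in> M - {e} \<and> P \<inter> X closure_of c = {}}"
      using False by blast
    ultimately show ?thesis
      using has_euler_deformation[OF f Pp(2)] IH Pp(1) by (simp add: subtopology_subtopology)
  qed
qed

lemma CW_euler:
  assumes "P \<subseteq> {p}"
  shows "has_euler (subtopology X (topspace X - P)) {} (\<Sum>e | e \<in> K \<and> P \<inter> X closure_of e = {}. (-1) ^ cell_dim X e)"
  using CW_euler_down_closed[of K P p] assms CW_Union by (simp add: dim_closed_def)

end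

lemma CW_ball_euler:
  assumes CW: "regular_CW (closed_ball n) K"
  shows "(\<Sum>e\<in>K. (-1) ^ cell_dim (closed_ball n) e) = (1::int)"
    and "p \<in> bsphere n \<Longrightarrow>
      (\<Sum>e | e \<in> K \<and> p \<in> closed_ball n closure_of e. (-1) ^ cell_dim (closed_ball n) e) = (0::int)"
proof -
  let ?X = "closed_ball n"
  have 1: "(\<Sum>e | e \<in> K \<and> P \<inter> ?X closure_of e = {}. (-1) ^ cell_dim ?X e) = (1::int)"
    if P: "P \<subseteq> {p}" "P \<subseteq> bsphere n" for P p
  proof (rule has_euler_unique[OF CW_euler[OF CW P(1)]])
    have "(\<lambda>_. 0) \<in> topspace ?X - P"
      using P(2) zero_in_open_ball[of n] open_ball_subset[of n] by (auto simp: bsphere_def)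
    then show "has_euler (subtopology ?X (topspace ?X - P)) {} 1"
      using contractible_star_ball[OF P(2)] by (intro has_euler_contractible) auto
  qed
  from 1[of "{}"] show a: "(\<Sum>e\<in>K. (-1) ^ cell_dim ?X e) = (1::int)" by simp
  assume p: "p \<in> bsphere n"
  have "(\<Sum>e\<in>K. (-1) ^ cell_dim ?X e) =
      (\<Sum>e | e \<in> K \<and> p \<in> ?X closure_of e. (-1) ^ cell_dim ?X e) +
      (\<Sum>e | e \<in> K \<and> p \<notin> ?X closure_of e. (-1) ^ cell_dim ?X e :: int)"
    using CW_finite[OF CW] by (subst sum.union_disjoint[symmetric]) (auto intro!: sum.cong)
  then show "(\<Sum>e | e \<in> K \<and> p \<in> ?X closure_of e. (-1) ^ cell_dim ?X e) = (0::int)"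
    using a 1[of "{p}" p] p by simp
qed

section \<open>Closed cells are unions of open cells\<close>

text \<open>Were \<open>m < k\<close>, the image would be open in dimension \<open>k\<close> by
  invariance of domain, yet contained in a proper coordinate subspace.\<close>

lemma Euclidean_embedding_dim_le:
  assumes U: "openin (Euclidean_space k) U" "U \<noteq> {}"
    and h: "continuous_map (subtopology (Euclidean_space k) U) (Euclidean_space m) h" "inj_on h U"
  shows "k \<le> m"
proof (rule ccontr)
  assume "\<not> k \<le> m"
  then have mk: "m < k" by simp
  have sub: "topspace (Euclidean_space m) \<subseteq> topspace (Euclidean_space k)"
    using mk by (auto simp: topspace_Euclidean_space)
  have im: "h ` U \<subseteq> topspace (Euclidean_space m)"
    using continuous_map_image_subset_topspace[OF h(1)] openin_subset[OF U(1)]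
    by (simp add: inf.absorb2)
  have "continuous_map (subtopology (Euclidean_space k) U) (Euclidean_space k) h"
    using h(1) sub unfolding cm_Euclidean_space_iff_continuous_on by blast
  from invariance_of_domain_Euclidean_space[OF U(1) this h(2)]
  show False using open_ball_not_flat[OF mk, of "h ` U"] im U(2) by blast
qed

text \<open>Charts of the sphere are avoided by passing to the open cone \<open>U\<close> over \<open>W\<close> and recording the norm as
  an additional coordinate, so that invariance of domain applies in Euclidean space.\<close>

lemma sphere_embedding_open:
  assumes W: "openin (subtopology (closed_ball m) (bsphere m)) W" "W \<noteq> {}"
    and u: "continuous_map (subtopology (closed_ball m) W) (Euclidean_space j) u" "inj_on u W"
    and jm: "j < m"
  shows "Suc j = m" "openin (Euclidean_space j) (u ` W)"
proof -
  define N where "N x = sqrt (\<Sum>i<m. (x i)\<^sup>2)" for x :: "nat \<Rightarrow> real"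
  define v where "v x = (\<lambda>i. x i / N x)" for x
  let ?E = "\<lambda>k. {x::nat \<Rightarrow> real. \<forall>i\<ge>k. x i = 0}"
  define U where "U = {x \<in> ?E m. N x \<noteq> 0 \<and> v x \<in> W}"
  define h where "h x = (\<lambda>i. if i < j then u (v x) i else if i = j then N x else 0)" for x
  have WS: "W \<subseteq> bsphere m" using openin_subset[OF W(1)] by auto
  have Nc: "continuous_on S N" for S
    unfolding N_def by (intro continuous_intros continuous_on_product_coordinates continuous_on_subset[OF _ subset_UNIV])
  have vc: "continuous_on {x \<in> ?E m. N x \<noteq> 0} v"
    unfolding v_def
    by (intro continuous_on_coordinatewise_then_product continuous_intros Nc
        continuous_on_subset[OF continuous_on_product_coordinates subset_UNIV]) auto
  have N0: "N x \<ge> 0" for x by (simp add: N_def sum_nonneg)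
  have N2: "(N x)\<^sup>2 = (\<Sum>i<m. (x i)\<^sup>2)" for x by (simp add: N_def sum_nonneg)
  have vs: "v x \<in> bsphere m" if "x \<in> ?E m" "N x \<noteq> 0" for x
    using that N2[of x] by (auto simp: v_def bsphere_eq power_divide simp flip: sum_divide_distrib)
  have NW: "N w = 1" "v w = w" if "w \<in> W" for w
  proof -
    show "N w = 1" using that WS by (auto simp: N_def bsphere_eq)
    then show "v w = w" by (simp add: v_def)
  qed
  have Eeq: "Euclidean_space k = top_of_set (?E k)" for k
    by (rule Euclidean_space_top_of_set)
  have top_sub: "subtopology (closed_ball m) S = top_of_set S" if "S \<subseteq> bsphere m" for S
    using that by (subst closed_ball_top_of_set) (auto simp: subtopology_subtopology bsphere_def inf.absorb2 intro!: arg_cong[where f = top_of_set])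
  have o1: "openin (top_of_set {x \<in> ?E m. N x \<noteq> 0}) ({x \<in> ?E m. N x \<noteq> 0} \<inter> v -` W)"
  proof (rule continuous_openin_preimage[OF vc])
    show "v \<in> {x \<in> ?E m. N x \<noteq> 0} \<rightarrow> bsphere m" using vs by blast
    show "openin (top_of_set (bsphere m)) W" using W(1) by (simp add: top_sub)
  qed
  have o2: "openin (top_of_set (?E m)) {x \<in> ?E m. N x \<noteq> 0}"
  proof -
    have "openin (top_of_set (?E m)) (?E m \<inter> N -` (- {0}))"
      by (rule continuous_openin_preimage_gen[OF Nc]) auto
    moreover have "?E m \<inter> N -` (- {0}) = {x \<in> ?E m. N x \<noteq> 0}" by auto
    ultimately show ?thesis by simp
  qed
  have "{x \<in> ?E m. N x \<noteq> 0} \<inter> v -` W = U" by (auto simp: U_def)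
  with openin_trans[OF o1 o2] have "openin (top_of_set (?E m)) U" by simp
  then have openU: "openin (Euclidean_space m) U" by (simp add: Eeq)
  obtain w where w: "w \<in> W" using W(2) by blast
  have WU: "W \<subseteq> U" using NW WS by (auto simp: U_def bsphere_eq)
  then have neU: "U \<noteq> {}" using w by blast
  have uc: "continuous_on W u" and uE: "\<And>x. x \<in> W \<Longrightarrow> u x \<in> ?E j"
    using u(1) by (auto simp: top_sub[OF WS] Eeq)
  have "continuous_on U (\<lambda>x. u (v x))"
    by (rule continuous_on_compose2[OF uc continuous_on_subset[OF vc]]) (auto simp: U_def)
  then have uvc: "continuous_on U (\<lambda>x. u (v x) i)" for i
    by (rule continuous_on_product_then_coordinatewise)
  have "continuous_on U h"
  proof (rule continuous_on_coordinatewise_then_product)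
    fix i
    consider "i < j" | "i = j" | "i > j" by linarith
    then show "continuous_on U (\<lambda>x. h x i)"
      by cases (use uvc Nc in \<open>auto simp: h_def\<close>)
  qed
  then have hc: "continuous_map (subtopology (Euclidean_space m) U) (Euclidean_space (Suc j)) h"
    unfolding cm_Euclidean_space_iff_continuous_on
    by (auto simp: topspace_Euclidean_space h_def elim: continuous_on_subset)
  have inj: "inj_on h U"
  proof (rule inj_onI)
    fix x y assume xy: "x \<in> U" "y \<in> U" "h x = h y"
    have N: "N x = N y" using fun_cong[OF xy(3), of j] by (simp add: h_def)
    have "u (v x) i = u (v y) i" for i
      using fun_cong[OF xy(3), of i] uE[of "v x"] uE[of "v y"] xy(1,2)
      by (cases "i < j") (auto simp: h_def U_def)
    then have "u (v x) = u (v y)" by blast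
    then have "v x = v y" using inj_onD[OF u(2)] xy(1,2) by (simp add: U_def)
    then have "x i / N x = y i / N x" for i using N by (metis v_def)
    then show "x = y" using xy(1) by (auto simp: U_def)
  qed
  \<comment> \<open>The cone has dimension \<open>m\<close> and is embedded in dimension
    \<open>j + 1\<close>; with \<open>j < m\<close> only equality remains.\<close>
  have "m \<le> Suc j" by (rule Euclidean_embedding_dim_le[OF openU neU hc inj])
  then show m: "Suc j = m" using jm by simp
  have openh: "openin (Euclidean_space (Suc j)) (h ` U)"
    using invariance_of_domain_Euclidean_space[of m U h] openU hc inj m by simp
  \<comment> \<open>The slice at height 1, where the cone is \<open>W\<close> itself: pulling the
    open image of the cone back along it gives the image of \<open>W\<close> under
    \<open>u\<close>.\<close>
  let ?s = "\<lambda>y. y(j := 1::real)"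
  have "continuous_on (?E j) ?s"
  proof (rule continuous_on_coordinatewise_then_product)
    show "continuous_on (?E j) (\<lambda>y. ?s y i)" for i
      by (cases "i = j") (auto intro: continuous_on_subset[OF continuous_on_product_coordinates])
  qed
  then have "openin (top_of_set (?E j)) (?E j \<inter> ?s -` (h ` U))"
    by (rule continuous_openin_preimage[where T = "?E (Suc j)"]) (use openh in \<open>auto simp: Eeq\<close>)
  moreover have "?E j \<inter> ?s -` (h ` U) = u ` W"
  proof (intro equalityI subsetI)
    fix y assume y: "y \<in> ?E j \<inter> ?s -` (h ` U)"
    then obtain x where x: "x \<in> U" "h x = ?s y" by auto
    have "y i = u (v x) i" for i
      using fun_cong[OF x(2), of i] y uE[of "v x"] x(1)
      by (cases "i < j") (auto simp: h_def U_def)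
    then have "y = u (v x)" by blast
    then show "y \<in> u ` W" using x(1) by (simp add: U_def)
  next
    fix y assume "y \<in> u ` W"
    then obtain x where x: "x \<in> W" "y = u x" by blast
    have "h x = ?s y"
    proof
      show "h x i = ?s y i" for i using NW[OF x(1)] uE[OF x(1)] x(2) by (simp add: h_def)
    qed
    then show "y \<in> ?E j \<inter> ?s -` (h ` U)" using x WU uE[OF x(1)] by (auto intro: rev_image_eqI)
  qed
  ultimately show "openin (Euclidean_space j) (u ` W)" by (simp add: Eeq)
qed

context
  fixes X :: "'a topology" and K :: "'a set set"
  assumes CW: "regular_CW X K"
begin

lemma CW_boundary_closed:
  assumes "e \<in> K"
  shows "closedin X (X closure_of e - e)"
proof -
  obtain f where f: "homeomorphic_map (closed_ball (cell_dim X e)) (subtopology X (X closure_of e)) f"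
    "f ` bsphere (cell_dim X e) = X closure_of e - e"
    by (rule CW_cell[OF CW assms])
  have "closedin (closed_ball (cell_dim X e)) (bsphere (cell_dim X e))"
    using attaches_closed_ball[of "cell_dim X e"] by (simp add: attaches_def)
  then have "closedin (subtopology X (X closure_of e)) (X closure_of e - e)"
    using f homeomorphic_imp_closed_map[OF f(1)] by (metis closed_map_def)
  then show ?thesis using closedin_trans_full closedin_closure_of by blast
qed

text \<open>The characteristic map of \<open>e\<close> pulls \<open>V\<close> back to an open set of
  a sphere, and the inverse characteristic map of \<open>c\<close> sends that set injectively into a
  Euclidean space of the dimension of \<open>c\<close>. Invariance of domain yields codimension one
  and openness.\<close>

lemma CW_boundary_open_in_cell:
  assumes e: "e \<in> K" and c: "c \<in> K" "cell_dim X c < cell_dim X e"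
    and V: "openin (subtopology X (X closure_of e - e)) V" "V \<subseteq> c" "V \<noteq> {}"
  shows "Suc (cell_dim X c) = cell_dim X e" "openin (subtopology X c) V"
proof -
  define m where "m = cell_dim X e"
  define j where "j = cell_dim X c"
  let ?S = "X closure_of e - e"
  obtain f where f: "homeomorphic_map (closed_ball m) (subtopology X (X closure_of e)) f"
    "f ` bsphere m = ?S"
    unfolding m_def by (rule CW_cell[OF CW e])
  obtain f' where f': "homeomorphic_map (closed_ball j) (subtopology X (X closure_of c)) f'"
    "f' ` open_ball j = c" "f' ` topspace (closed_ball j) = X closure_of c"
    unfolding j_def by (rule CW_cell[OF CW c(1)])
  obtain g' where g': "homeomorphic_maps (closed_ball j) (subtopology X (X closure_of c)) f' g'"
    using f'(1) homeomorphic_map_maps by blast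
  have cl: "X closure_of c \<subseteq> topspace X" by (rule closure_of_subset_topspace)
  have cc: "c \<subseteq> X closure_of c" by (rule CW_subset_closure[OF CW c(1)])
  have gf: "\<And>x. x \<in> topspace (closed_ball j) \<Longrightarrow> g' (f' x) = x"
    and fg: "\<And>x. x \<in> X closure_of c \<Longrightarrow> f' (g' x) = x"
    and g'c: "continuous_map (subtopology X (X closure_of c)) (closed_ball j) g'"
    using g' cl by (auto simp: homeomorphic_maps_def)
  have g'o: "g' x \<in> open_ball j" if "x \<in> c" for x
    using that f'(2) gf open_ball_subset[of j] by auto
  have VS: "V \<subseteq> ?S" using openin_subset[OF V(1)] by auto
  have inj: "inj_on f (topspace (closed_ball m))"
    using homeomorphic_imp_injective_map[OF f(1)] .
  have sB: "bsphere m \<subseteq> topspace (closed_ball m)" by (auto simp: bsphere_def)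
  define W where "W = {x \<in> bsphere m. f x \<in> V}"
  have fW: "f ` W = V" using f(2) VS by (auto simp: W_def)
  have fc: "continuous_map (closed_ball m) X f"
    using homeomorphic_imp_continuous_map[OF f(1)] continuous_map_in_subtopology by blast
  have "continuous_map (subtopology (closed_ball m) (bsphere m)) (subtopology X ?S) f"
    using continuous_map_from_subtopology[OF fc] f(2) sB by (auto simp: continuous_map_in_subtopology)
  from openin_continuous_map_preimage[OF this V(1)]
  have W: "openin (subtopology (closed_ball m) (bsphere m)) W"
    using sB by (simp add: W_def inf.absorb2)
  have WS: "W \<subseteq> bsphere m" by (auto simp: W_def)
  have "continuous_map (subtopology (closed_ball m) W) (subtopology X (X closure_of c)) f"
    using continuous_map_from_subtopology[OF fc] fW V(2) cc by (auto simp: continuous_map_in_subtopology)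
  from continuous_map_compose[OF this g'c]
  have "continuous_map (subtopology (closed_ball m) W) (closed_ball j) (g' \<circ> f)" .
  then have u: "continuous_map (subtopology (closed_ball m) W) (Euclidean_space j) (g' \<circ> f)"
    unfolding closed_ball_def using continuous_map_in_subtopology by blast
  have "inj_on g' V"
    using fg V(2) cc by (metis inj_on_def subsetD)
  then have inju: "inj_on (g' \<circ> f) W"
    using inj_on_subset[OF inj] WS sB fW by (intro comp_inj_on) auto
  have neW: "W \<noteq> {}" using fW V(3) by auto
  have jm: "j < m" using c by (simp add: j_def m_def)
  note emb = sphere_embedding_open[OF W neW u inju jm]
  show "Suc (cell_dim X c) = cell_dim X e" using emb(1) by (simp add: j_def m_def)
  let ?V = "g' ` V"
  have "openin (Euclidean_space j) ?V" using emb(2) unfolding image_comp[symmetric] fW .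
  moreover have "?V \<subseteq> topspace (closed_ball j)" using g'o V(2) open_ball_subset by blast
  ultimately have "openin (closed_ball j) ?V"
    unfolding closed_ball_def by (auto simp: openin_subtopology topspace_subtopology)
  then have "openin (subtopology X (X closure_of c)) (f' ` ?V)"
    using homeomorphic_imp_open_map[OF f'(1)] by (simp add: open_map_def)
  moreover have "f' ` ?V = V" using fg V(2) cc by force
  ultimately show "openin (subtopology X c) V"
    using V(2) cc unfolding openin_subtopology by (metis inf.absorb_iff2 inf.assoc inf.commute)
qed

text \<open>The cells other than \<open>c\<close> of dimension at most that of \<open>c\<close> have
  a closed union, and what remains of \<open>V\<close> outside it lies in \<open>c\<close>.\<close>

lemma CW_maximal_cell_open:
  assumes VX: "V \<subseteq> topspace X" "V \<subseteq> S" and V: "openin (subtopology X S) V"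
    and c: "c \<in> K" and max: "\<And>b. b \<in> K \<Longrightarrow> b \<inter> V \<noteq> {} \<Longrightarrow> cell_dim X b \<le> cell_dim X c"
  shows "openin (subtopology X S) (V \<inter> c)"
proof -
  let ?M = "{b \<in> K. cell_dim X b \<le> cell_dim X c \<and> b \<noteq> c}"
  have "dim_closed X K ?M" by (auto simp: dim_closed_def)
  then have cl: "closedin X (\<Union>?M)" by (rule CW_closed_Union[OF CW])
  have "V \<inter> c = V - \<Union>?M"
  proof (intro equalityI subsetI)
    fix x assume "x \<in> V \<inter> c"
    then show "x \<in> V - \<Union>?M" using CW_disjoint[OF CW _ c] by blast
  next
    fix x assume x: "x \<in> V - \<Union>?M"
    then have "x \<in> \<Union>K" using VX(1) unfolding CW_Union[OF CW] by blast
    then obtain b where b: "b \<in> K" "x \<in> b" by blast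
    then have "cell_dim X b \<le> cell_dim X c" using x max[of b] by blast
    then have "b = c" using b x by blast
    then show "x \<in> V \<inter> c" using b x by blast
  qed
  moreover have "V - \<Union>?M = V - \<Union>?M \<inter> S" using VX by blast
  moreover have "openin (subtopology X S) (V - \<Union>?M \<inter> S)"
    using cl by (intro openin_diff V) (auto simp: closedin_subtopology)
  ultimately show ?thesis by simp
qed

text \<open>The open ball is the star-shaped ball with its whole boundary sphere removed, hence
  contractible.\<close>

lemma CW_connected_cell:
  assumes "e \<in> K"
  shows "connected_space (subtopology X e)"
proof -
  let ?k = "cell_dim X e"
  have "topspace (closed_ball ?k) - bsphere ?k = open_ball ?k"
    using open_ball_subset by (auto simp: bsphere_def)
  then have "contractible_space (subtopology (closed_ball ?k) (open_ball ?k))"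
    using contractible_star_ball[of "bsphere ?k" ?k] by simp
  then have "connectedin (closed_ball ?k) (open_ball ?k)"
    using contractible_imp_connected_space open_ball_subset by (auto simp: connectedin_def)
  moreover obtain f where f: "homeomorphic_map (closed_ball ?k) (subtopology X (X closure_of e)) f"
    "f ` open_ball ?k = e"
    by (rule CW_cell[OF CW assms])
  moreover have "continuous_map (closed_ball ?k) X f"
    using homeomorphic_imp_continuous_map[OF f(1)] continuous_map_in_subtopology by blast
  ultimately have "connectedin X e" using connectedin_continuous_map_image by metis
  then show ?thesis by (simp add: connectedin_def)
qed

text \<open>If \<open>z\<close> were in none of the closed cells contained in the boundary, the remaining open part \<open>V\<close> of the
  boundary sphere would meet some cell \<open>c\<close> of maximal dimension in an open set. By invariance of
  domain \<open>c\<close> has codimension one, and then its trace on the boundary is clopen in \<open>c\<close>, so that \<open>c\<close>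
  lies in the boundary after all.\<close>

lemma CW_boundary_facet:
  assumes e: "e \<in> K" and z: "z \<in> X closure_of e - e"
  obtains c where "c \<in> K" "c \<subseteq> X closure_of e - e" "cell_dim X c < cell_dim X e" "z \<in> X closure_of c"
proof (rule ccontr)
  note that' = that
  assume neg: "\<not> thesis"
  let ?S = "X closure_of e - e"
  let ?F = "{c \<in> K. cell_dim X c < cell_dim X e \<and> c \<subseteq> ?S}"
  define V where "V = ?S - \<Union>((closure_of) X ` ?F)"
  have SX: "?S \<subseteq> topspace X" using closure_of_subset_topspace[of X e] by blast
  have S: "openin (subtopology X ?S) ?S" using SX by (simp add: openin_subtopology_refl)
  have "closedin X (\<Union>((closure_of) X ` ?F))"
    using CW_finite[OF CW] by (intro closedin_Union) auto
  then have "closedin (subtopology X ?S) (\<Union>((closure_of) X ` ?F) \<inter> ?S)"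
    unfolding closedin_subtopology by blast
  then have "openin (subtopology X ?S) (?S - \<Union>((closure_of) X ` ?F) \<inter> ?S)"
    by (rule openin_diff[OF S])
  moreover have "?S - \<Union>((closure_of) X ` ?F) \<inter> ?S = V" by (auto simp: V_def)
  ultimately have V: "openin (subtopology X ?S) V" by simp
  have VS: "V \<subseteq> ?S" by (auto simp: V_def)
  have zV: "z \<in> V" using z neg that' by (auto simp: V_def)
  have lower: "cell_dim X b < cell_dim X e" if "b \<in> K" "x \<in> b" "x \<in> ?S" for b x
  proof -
    obtain c where "c \<in> K" "cell_dim X c < cell_dim X e" "x \<in> c"
      using CW_closure_minus[OF CW e] \<open>x \<in> ?S\<close> by blast
    then show ?thesis using CW_disjoint[OF CW that(1)] that(2) by metis
  qed
  let ?M = "{b \<in> K. b \<inter> V \<noteq> {}}"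
  have "z \<in> \<Union>K" using z SX unfolding CW_Union[OF CW] by blast
  then have M: "finite ?M" "?M \<noteq> {}" using zV CW_finite[OF CW] by auto
  obtain c where "c \<in> ?M" "\<forall>b\<in>?M. cell_dim X b \<le> cell_dim X c"
    using finite_maximal_cell[OF M, of X] by blast
  then have c: "c \<in> K" "c \<inter> V \<noteq> {}"
    and max: "\<And>b. b \<in> K \<Longrightarrow> b \<inter> V \<noteq> {} \<Longrightarrow> cell_dim X b \<le> cell_dim X c"
    by auto
  obtain x where x: "x \<in> c" "x \<in> V" using c(2) by blast
  have ce: "cell_dim X c < cell_dim X e" using lower[OF c(1) x(1)] x(2) VS by blast
  have "openin (subtopology X ?S) (V \<inter> c)"
    by (rule CW_maximal_cell_open[OF _ VS V c(1) max]) (use VS SX in blast)+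
  from CW_boundary_open_in_cell(1)[OF e c(1) ce this] x
  have dim: "Suc (cell_dim X c) = cell_dim X e" by blast
  \<comment> \<open>So far \<open>c\<close> is maximal only among the cells meeting
    \<open>V\<close>. Codimension one makes it maximal among all cells meeting the boundary of
    \<open>e\<close>, so the openness argument can be repeated with the whole boundary.\<close>
  have "openin (subtopology X ?S) (?S \<inter> c)"
  proof (rule CW_maximal_cell_open[OF SX order_refl S c(1)])
    fix b assume "b \<in> K" "b \<inter> ?S \<noteq> {}"
    then obtain y where "y \<in> b" "y \<in> ?S" by blast
    then show "cell_dim X b \<le> cell_dim X c" using lower[OF \<open>b \<in> K\<close>] dim by fastforce
  qed
  from CW_boundary_open_in_cell(2)[OF e c(1) ce this] x VS
  have "openin (subtopology X c) (?S \<inter> c)" by blast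
  moreover have "closedin (subtopology X c) (?S \<inter> c)"
    using CW_boundary_closed[OF e] by (auto simp: closedin_subtopology)
  ultimately have "?S \<inter> c = {} \<or> ?S \<inter> c = topspace (subtopology X c)"
    using CW_connected_cell[OF c(1)] unfolding connected_space_clopen_in by blast
  moreover have "c \<subseteq> topspace X" using c(1) CW_Union[OF CW] by blast
  moreover have "?S \<inter> c \<noteq> {}" using x VS by blast
  ultimately have "c \<subseteq> ?S" by auto
  then have "c \<in> ?F" using c(1) ce by simp
  moreover have "x \<in> X closure_of c" using x(1) CW_subset_closure[OF CW c(1)] by blast
  ultimately show False using x(2) unfolding V_def by blast
qed

text \<open>Induction on the dimension of \<open>e\<close>: a boundary point lies in the closure of
  a cell of smaller dimension that is itself contained in the boundary.\<close>

lemma CW_closure_subset: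
  assumes "e \<in> K" "c \<in> K" "c \<inter> X closure_of e \<noteq> {}"
  shows "c \<subseteq> X closure_of e"
  using assms
proof (induction "cell_dim X e" arbitrary: e rule: less_induct)
  case less
  obtain z where z: "z \<in> c" "z \<in> X closure_of e" using less.prems(3) by blast
  show ?case
  proof (cases "z \<in> e")
    case True
    then have "c = e" using CW_disjoint[OF CW less.prems(2,1) z(1)] by simp
    then show ?thesis using CW_subset_closure[OF CW less.prems(1)] by simp
  next
    case False
    then obtain b where b: "b \<in> K" "b \<subseteq> X closure_of e - e" "cell_dim X b < cell_dim X e" "z \<in> X closure_of b"
      using CW_boundary_facet[OF less.prems(1), of z] z(2) by blast
    have "c \<subseteq> X closure_of b" using less.hyps[OF b(3,1) less.prems(2)] b(4) z(1) by blast
    also have "X closure_of b \<subseteq> X closure_of e"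
      using b(2) by (intro closure_of_minimal) auto
    finally show ?thesis .
  qed
qed

end

section \<open>Faces of a subdivided ball\<close>

text \<open>Every \<open>p\<close> is the limit of \<open>(1 - t) p\<close> as \<open>t\<close>
  decreases to 0. This makes the open ball the greatest face.\<close>

lemma closure_of_open_ball: "closed_ball n closure_of open_ball n = topspace (closed_ball n)"
proof
  show "topspace (closed_ball n) \<subseteq> closed_ball n closure_of open_ball n"
  proof
    fix p assume p: "p \<in> topspace (closed_ball n)"
    define h where "h t = (\<lambda>i. (1 - t) * p i)" for t :: real
    have norm: "(\<Sum>i<n. (h t i)\<^sup>2) = (1 - t)\<^sup>2 * (\<Sum>i<n. (p i)\<^sup>2)" for t
      by (simp add: h_def power_mult_distrib sum_distrib_left)
    have le: "(\<Sum>i<n. (h t i)\<^sup>2) \<le> (1 - t)\<^sup>2" for t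
      unfolding norm using p mult_left_mono[of "\<Sum>i<n. (p i)\<^sup>2" 1 "(1 - t)\<^sup>2"] by (simp add: topspace_closed_ball)
    have lt: "(1 - t)\<^sup>2 < 1" if "t \<in> {0<..1}" for t :: real
      using that by (simp add: power_less_one_iff abs_if)
    have "continuous_on {0..1} h"
      unfolding h_def by (intro continuous_on_coordinatewise_then_product continuous_intros)
    moreover have "h t \<in> topspace (closed_ball n)" if "t \<in> {0..1}" for t
    proof -
      have "(1 - t)\<^sup>2 \<le> 1" using that by (simp add: power_le_one)
      then show ?thesis using le[of t] p by (auto simp: topspace_closed_ball h_def)
    qed
    ultimately have "continuous_map (top_of_set {0..1}) (closed_ball n) h"
      by (subst closed_ball_top_of_set) auto
    then have "h ` (top_of_set {0..1} closure_of {0<..1}) \<subseteq> closed_ball n closure_of h ` {0<..1}"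
      by (rule continuous_map_image_closure_subset)
    moreover have "0 \<in> top_of_set {0..1::real} closure_of {0<..1}"
      by (simp add: closure_of_subtopology closure_greaterThanAtMost Int_absorb1 greaterThanAtMost_subseteq_atLeastAtMost_iff)
    moreover have "h 0 = p" by (simp add: h_def)
    moreover have "h ` {0<..1} \<subseteq> open_ball n"
    proof
      fix x assume "x \<in> h ` {0<..1}"
      then obtain t where t: "t \<in> {0<..1}" "x = h t" by blast
      then show "x \<in> open_ball n"
        using le[of t] lt[of t] p by (auto simp: open_ball_eq topspace_closed_ball h_def)
    qed
    ultimately show "p \<in> closed_ball n closure_of open_ball n"
      using closure_of_mono by (metis image_subset_iff subsetD)
  qed
qed (rule closure_of_subset_topspace)

lemma CW_ball_dim_le:
  assumes CW: "regular_CW (closed_ball n) K" and e: "e \<in> K"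
  shows "cell_dim (closed_ball n) e \<le> n"
proof -
  let ?k = "cell_dim (closed_ball n) e"
  obtain f where f: "homeomorphic_map (closed_ball ?k) (subtopology (closed_ball n) (closed_ball n closure_of e)) f"
    by (rule CW_cell[OF CW e])
  have "continuous_map (closed_ball ?k) (Euclidean_space n) f"
    using homeomorphic_imp_continuous_map[OF f] unfolding closed_ball_def[of n] continuous_map_in_subtopology by blast
  then have "continuous_map (subtopology (closed_ball ?k) (open_ball ?k)) (Euclidean_space n) f"
    by (rule continuous_map_from_subtopology)
  moreover have "subtopology (closed_ball ?k) (open_ball ?k) = subtopology (Euclidean_space ?k) (open_ball ?k)"
    using open_ball_subset[of ?k] unfolding closed_ball_def
    by (simp add: subtopology_subtopology inf.absorb2)
  moreover have "inj_on f (open_ball ?k)"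
    using homeomorphic_imp_injective_map[OF f] open_ball_subset inj_on_subset by blast
  ultimately show ?thesis
    using Euclidean_embedding_dim_le[OF openin_open_ball] zero_in_open_ball by (metis empty_iff)
qed

locale ball_CW =
  fixes n :: nat and K :: "(nat \<Rightarrow> real) set set"
  assumes n: "n \<ge> 1" and CW: "regular_CW (closed_ball n) K"
    and top_cell: "{e \<in> K. cell_dim (closed_ball n) e = n} = {open_ball n}"
begin

abbreviation "X \<equiv> closed_ball n"
abbreviation "\<rho> \<equiv> face_rank (closed_ball n)"
abbreviation "T \<equiv> open_ball n"

lemma T_cell: "T \<in> K" "cell_dim X T = n"
  using top_cell by auto

lemma T_nonempty: "T \<noteq> {}" using zero_in_open_ball by blast

lemma T_face: "T \<in> faces K" by (simp add: faces_def T_cell)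

lemma rank_T: "\<rho> T = n + 1" by (simp add: face_rank_def T_cell T_nonempty)

lemma empty_face: "{} \<in> faces K" by (simp add: faces_def)

lemma finite_faces: "finite (faces K)"
  using CW_finite[OF CW] by (simp add: faces_def)

lemma face_subset_topspace: "x \<in> faces K \<Longrightarrow> x \<subseteq> topspace X"
  using CW_Union[OF CW] by (auto simp: faces_def)

lemma rank_le: "x \<in> faces K \<Longrightarrow> x \<noteq> T \<Longrightarrow> \<rho> x \<le> n"
proof -
  assume x: "x \<in> faces K" "x \<noteq> T"
  show ?thesis
  proof (cases "x = {}")
    case False
    then have xK: "x \<in> K" using x by (simp add: faces_def)
    have "cell_dim X x \<noteq> n" using top_cell xK x(2) by blast
    then show ?thesis using CW_ball_dim_le[OF CW xK] False by (simp add: face_rank_def)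
  qed (simp add: face_rank_def)
qed

lemma rank_le_Suc: "x \<in> faces K \<Longrightarrow> \<rho> x \<le> n + 1"
  using rank_le[of x] rank_T by (cases "x = T") auto

text \<open>Here \<open>x \<noteq> T\<close> provides points on the boundary sphere, where the count
  for the punctured ball applies.\<close>

lemma face_subset_bsphere: "x \<in> faces K \<Longrightarrow> x \<noteq> T \<Longrightarrow> x \<subseteq> bsphere n"
  using CW_disjoint[OF CW _ T_cell(1)] face_subset_topspace[of x] by (fastforce simp: bsphere_def faces_def)

lemma face_le_iff:
  assumes "x \<in> faces K"
  shows "face_le X x y \<longleftrightarrow> x \<subseteq> X closure_of y"
proof
  assume "face_le X x y"
  then show "x \<subseteq> X closure_of y"
    using closure_of_subset[OF face_subset_topspace[OF assms]] by (auto simp: face_le_def)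
qed (simp add: face_le_def closure_of_minimal)

text \<open>For empty \<open>x\<close> all faces count: the empty face gives 1, and the cells, whose
  rank is dimension plus one, give minus the Euler characteristic of the ball. Otherwise a point
  \<open>p\<close> of \<open>x\<close> stands for \<open>x\<close>: closed cells of \<Gamma> are
  unions of closed cells of \<open>K\<close>, and these contain \<open>x\<close> once they contain
  \<open>p\<close>.\<close>

lemma euler_upper:
  assumes G: "regular_CW X \<Gamma>" and ref: "cw_refines X K \<Gamma>" and x: "x \<in> faces K" "x \<noteq> T"
  shows "(\<Sum>F | F \<in> faces \<Gamma> \<and> x \<subseteq> X closure_of F. (-1) ^ \<rho> F) = (0::int)"
proof -
  have ne: "{} \<notin> \<Gamma>" using CW_nonempty[OF G] by blast
  have rank: "\<rho> F = Suc (cell_dim X F)" if "F \<in> \<Gamma>" for F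
    using that ne by (auto simp: face_rank_def)
  show ?thesis
  proof (cases "x = {}")
    case True
    have "(\<Sum>F | F \<in> faces \<Gamma> \<and> x \<subseteq> X closure_of F. (-1) ^ \<rho> F) = (\<Sum>F\<in>insert {} \<Gamma>. (-1) ^ \<rho> F :: int)"
      using True by (auto simp: faces_def intro!: sum.cong)
    also have "\<dots> = 1 - (\<Sum>F\<in>\<Gamma>. (-1) ^ cell_dim X F)"
      using ne CW_finite[OF G] rank by (simp add: face_rank_def[of _ "{}"] sum_negf)
    finally show ?thesis using CW_ball_euler(1)[OF G] by simp
  next
    case False
    then have xK: "x \<in> K" using x(1) by (simp add: faces_def)
    obtain p where p: "p \<in> x" using False by blast
    have "p \<in> bsphere n" using face_subset_bsphere[OF x] p by blast
    note eul = CW_ball_euler(2)[OF G this]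
    have "{F. F \<in> faces \<Gamma> \<and> x \<subseteq> X closure_of F} = {F. F \<in> \<Gamma> \<and> p \<in> X closure_of F}"
    proof (intro equalityI subsetI)
      fix F assume "F \<in> {F. F \<in> faces \<Gamma> \<and> x \<subseteq> X closure_of F}"
      then show "F \<in> {F. F \<in> \<Gamma> \<and> p \<in> X closure_of F}" using p by (auto simp: faces_def)
    next
      fix F assume F: "F \<in> {F. F \<in> \<Gamma> \<and> p \<in> X closure_of F}"
      then obtain M where M: "M \<subseteq> K" "X closure_of F = \<Union>((closure_of) X ` M)"
        using ref unfolding cw_refines_def by blast
      then obtain e where e: "e \<in> M" "p \<in> X closure_of e" using F by blast
      then have "x \<subseteq> X closure_of e"
        using CW_closure_subset[OF CW _ xK, of e] M(1) p by blast
      then show "F \<in> {F. F \<in> faces \<Gamma> \<and> x \<subseteq> X closure_of F}"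
        using F M(2) e(1) by (auto simp: faces_def)
    qed
    then have "(\<Sum>F | F \<in> faces \<Gamma> \<and> x \<subseteq> X closure_of F. (-1) ^ \<rho> F) =
        - (\<Sum>F | F \<in> \<Gamma> \<and> p \<in> X closure_of F. (-1) ^ cell_dim X F :: int)"
      using rank by (simp add: sum_negf[symmetric])
    then show ?thesis using eul by simp
  qed
qed

lemma refines_refl: "cw_refines X K K"
  unfolding cw_refines_def
proof
  fix F assume "F \<in> K"
  then show "\<exists>M\<subseteq>K. X closure_of F = \<Union>((closure_of) X ` M)"
    by (intro exI[of _ "{F}"]) simp
qed

lemma euler_interval:
  assumes "x \<in> faces K" "x \<noteq> T"
  shows "(\<Sum>y | y \<in> faces K \<and> face_le X x y. (-1) ^ \<rho> y) = (0::int)"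
  using euler_upper[OF CW refines_refl assms] face_le_iff[OF assms(1)] by simp

end

section \<open>Chains in semisuspensions\<close>

text \<open>The part of a chain below \<open>Star\<close> and the greatest element, common to all
  semisuspensions in which it occurs. Its last entry governs how it continues.\<close>

definition face_chains :: "'a topology \<Rightarrow> 'a set set \<Rightarrow> 'a set list set"
  where "face_chains X D = {c. c \<noteq> [] \<and> hd c = {} \<and> set c \<subseteq> D \<and>
    sorted_wrt (\<lambda>x y. face_le X x y \<and> x \<noteq> y) c}"

text \<open>Each step carries its trailing \<open>vb\<close>, because a prefix is always followed by
  a further element. There are no zeta factors, as they equal 1 between faces.\<close>

fun prefix_weight :: "'a topology \<Rightarrow> 'a set list \<Rightarrow> ab_poly"
  where
    "prefix_weight X (x # y # c) = (va - vb) ^ (face_rank X y - face_rank X x - 1) * vb * prefix_weight X (y # c)"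
  | "prefix_weight X _ = 1"

lemma finite_face_chains:
  assumes "finite D"
  shows "finite (face_chains X D)"
proof -
  have "distinct c" if "sorted_wrt (\<lambda>x y. face_le X x y \<and> x \<noteq> y) c" for c
    using that by (induction c) auto
  then have "face_chains X D \<subseteq> {c. set c \<subseteq> D \<and> distinct c}"
    by (auto simp: face_chains_def)
  then show ?thesis
    using finite_subset_distinct[OF assms] finite_subset by blast
qed

text \<open>\<open>\<phi>\<close> is \<open>Face\<close> for semisuspensions and the identity for
  the face poset, so that both share the same prefix weights.\<close>

lemma chain_weight_prefix:
  assumes "\<And>x y. pzeta P (\<phi> x) (\<phi> y) = 1" "\<And>x. prank P (\<phi> x) = face_rank X x" and "c \<noteq> []"
  shows "chain_weight P (map \<phi> c @ t # ts) = prefix_weight X c * chain_weight P (\<phi> (last c) # t # ts)"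
  using assms(3)
proof (induction c rule: induct_list012)
  case (3 x y c)
  obtain z zs where "map \<phi> c @ t # ts = z # zs" by (cases "map \<phi> c @ t # ts") auto
  then show ?case using "3.IH"(2) assms(1,2) by (simp add: mult.assoc)
qed auto

lemma face_chain_le_last:
  assumes "c \<in> face_chains X D" "x \<in> set c"
  shows "face_le X x (last c)"
proof -
  have "c \<noteq> []" "sorted_wrt (\<lambda>x y. face_le X x y \<and> x \<noteq> y) c"
    using assms(1) by (auto simp: face_chains_def)
  moreover from this(1) obtain b t where "c = b @ [t]" by (metis rev_exhaust)
  ultimately show ?thesis using assms(2) by (auto simp: sorted_wrt_append face_le_def)
qed

context ball_CW
begin

lemma face_le_T: "x \<in> faces K \<Longrightarrow> face_le X x T"
  by (simp add: face_le_def closure_of_open_ball closure_of_subset_topspace)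

lemma face_le_empty: "x \<in> faces K \<Longrightarrow> face_le X x {} \<Longrightarrow> x = {}"
  by (simp add: face_le_iff)

lemma maxmin_chains_face_poset:
  "maxmin_chains (face_poset X K) = (\<lambda>c. c @ [T]) ` face_chains X (faces K - {T})"
proof (intro equalityI subsetI)
  fix xs assume xs: "xs \<in> maxmin_chains (face_poset X K)"
  then have "xs \<noteq> []" by (auto simp: maxmin_chains_def)
  then obtain c t where c: "xs = c @ [t]" by (metis rev_exhaust)
  have cne: "c \<noteq> []" using xs c by (auto simp: maxmin_chains_def)
  have el: "set c \<subseteq> faces K" "t \<in> faces K" and lt: "\<And>x. x \<in> set c \<Longrightarrow> face_le X x t \<and> x \<noteq> t"
    and srt: "sorted_wrt (\<lambda>x y. face_le X x y \<and> x \<noteq> y) c"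
    and hd: "face_le X (hd c) {}" and top: "face_le X T t"
    using xs cne T_face empty_face by (auto simp: c maxmin_chains_def face_poset_def plt_def[abs_def] sorted_wrt_append)
  have t: "t = T" using face_le_antisym[OF CW el(2) T_face face_le_T[OF el(2)] top] .
  have "hd c \<in> faces K" using el(1) cne hd_in_set by blast
  then have "hd c = {}" using face_le_empty hd by blast
  then have "c \<in> face_chains X (faces K - {T})"
    using cne el(1) srt lt t by (auto simp: face_chains_def)
  then show "xs \<in> (\<lambda>c. c @ [T]) ` face_chains X (faces K - {T})" using c t by blast
next
  fix xs assume "xs \<in> (\<lambda>c. c @ [T]) ` face_chains X (faces K - {T})"
  then obtain c where c: "xs = c @ [T]" "c \<noteq> []" "hd c = {}" "set c \<subseteq> faces K - {T}"
    "sorted_wrt (\<lambda>x y. face_le X x y \<and> x \<noteq> y) c"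
    by (auto simp: face_chains_def)
  then show "xs \<in> maxmin_chains (face_poset X K)"
    using T_face face_le_T
    by (auto simp: maxmin_chains_def face_poset_def plt_def[abs_def] sorted_wrt_append Suc_le_eq face_le_def[of _ "{}"])
qed

lemma ab_index_face_poset:
  "ab_index (face_poset X K) =
    (\<Sum>c\<in>face_chains X (faces K - {T}). prefix_weight X c * (va - vb) ^ (n - \<rho> (last c)))"
proof -
  let ?P = "face_poset X K"
  have "ab_index ?P = (\<Sum>c\<in>face_chains X (faces K - {T}). chain_weight ?P (c @ [T]))"
    unfolding ab_index_def maxmin_chains_face_poset
    by (subst sum.reindex) (auto simp: inj_on_def)
  also have "\<dots> = (\<Sum>c\<in>face_chains X (faces K - {T}). prefix_weight X c * (va - vb) ^ (n - \<rho> (last c)))"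
  proof (rule sum.cong[OF refl])
    fix c assume "c \<in> face_chains X (faces K - {T})"
    then have "c \<noteq> []" by (simp add: face_chains_def)
    from chain_weight_prefix[of ?P "\<lambda>x. x" X c T "[]", OF _ _ this]
    show "chain_weight ?P (c @ [T]) = prefix_weight X c * (va - vb) ^ (n - \<rho> (last c))"
      by (simp add: face_poset_def rank_T)
  qed
  finally show ?thesis .
qed

text \<open>Only \<open>Top\<close> can follow \<open>Star\<close>, so a chain of faces is completed
  either directly or through \<open>Star\<close>, the latter only from a face of rank below
  \<open>n\<close>.\<close>

lemma maxmin_chains_Semi:
  assumes D: "D \<subseteq> faces K - {T}" "{} \<in> D"
  shows "maxmin_chains (Semi X D n) =
    (\<lambda>c. map Face c @ [Top]) ` face_chains X D \<union>
    (\<lambda>c. map Face c @ [Star, Top]) ` {c \<in> face_chains X D. \<rho> (last c) < n}"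
    (is "?M = ?A \<union> ?B")
proof (intro equalityI subsetI)
  let ?P = "Semi X D n"
  have chain: "c \<in> face_chains X D"
    if "c \<noteq> []" "set c \<subseteq> D" "face_le X (hd c) {}" "sorted_wrt (plt ?P) (map Face c)" for c
  proof -
    have "hd c = {}" using face_le_empty[of "hd c"] that D(1) by (meson DiffD1 hd_in_set subsetD)
    moreover have "sorted_wrt (\<lambda>x y. face_le X x y \<and> x \<noteq> y) c"
      using that(4) by (simp add: sorted_wrt_map plt_def Semi_def)
    ultimately show ?thesis using that by (simp add: face_chains_def)
  qed
  fix xs assume xs: "xs \<in> ?M"
  then have el: "set xs \<subseteq> elems ?P" and len: "length xs \<ge> 2" and srt: "sorted_wrt (plt ?P) xs"
    and hd: "ple ?P (hd xs) (Face {})" and top: "ple ?P Top (last xs)"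
    using D(2) by (auto simp: maxmin_chains_def Semi_def)
  have "xs \<noteq> []" using len by auto
  then obtain ys t where ys: "xs = ys @ [t]" by (metis rev_exhaust)
  have t: "t = Top" using top ys by (cases t) (auto simp: Semi_def)
  have ysne: "ys \<noteq> []" using len ys by auto
  have srty: "sorted_wrt (plt ?P) ys" and noTop: "Top \<notin> set ys"
    using srt ys t by (auto simp: sorted_wrt_append plt_def)
  show "xs \<in> ?A \<union> ?B"
  proof (cases "Star \<in> set ys")
    case False
    have "\<forall>y\<in>set ys. \<exists>x. y = Face x" using False noTop by (metis semi_face.exhaust)
    then obtain c where c: "ys = map Face c" by (metis ex_map_conv)
    have "c \<in> face_chains X D"
      using c ysne el ys hd srty by (intro chain) (auto simp: Semi_def hd_map)
    then show ?thesis using ys t c by auto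
  next
    case True
    then obtain us vs where uv: "ys = us @ Star # vs" by (meson split_list)
    have "vs = []"
    proof (rule ccontr)
      assume "vs \<noteq> []"
      then obtain v where v: "v \<in> set vs" by (cases vs) auto
      then have "plt ?P Star v" "v \<noteq> Top" using srty noTop uv by (auto simp: sorted_wrt_append)
      then show False by (cases v) (auto simp: plt_def Semi_def)
    qed
    have us: "plt ?P u Star" "u \<noteq> Top" if "u \<in> set us" for u
      using that srty noTop uv by (auto simp: sorted_wrt_append)
    have "\<forall>y\<in>set us. \<exists>x. y = Face x" using us by (metis plt_def semi_face.exhaust)
    then obtain c where c: "us = map Face c" by (metis ex_map_conv)
    have "us \<noteq> []" using hd ys uv by (auto simp: Semi_def)
    then have cne: "c \<noteq> []" using c by simp
    have "c \<in> face_chains X D"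
      using c cne el ys uv hd srty by (intro chain) (auto simp: Semi_def hd_map sorted_wrt_append)
    moreover have "\<rho> (last c) < n"
      using us[of "Face (last c)"] c cne by (simp add: plt_def Semi_def)
    ultimately show ?thesis using ys t c uv \<open>vs = []\<close> by auto
  qed
next
  let ?P = "Semi X D n"
  have nonneg: "face_le X {} y" for y by (simp add: face_le_def)
  have n0: "n > 0" using n by simp
  have r0: "\<rho> {} = 0" by (simp add: face_rank_def)
  have mono: "\<rho> x \<le> \<rho> (last c)" if "c \<in> face_chains X D" "x \<in> set c" for c x
  proof -
    have "c \<noteq> []" "set c \<subseteq> D" using that(1) by (auto simp: face_chains_def)
    then have "x \<in> faces K" "last c \<in> faces K" using that(2) D(1) last_in_set by blast+
    then show ?thesis
      using face_rank_less[OF CW _ _ face_chain_le_last[OF that]] by (cases "x = last c") auto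
  qed
  fix xs assume "xs \<in> ?A \<union> ?B"
  then consider c where "c \<in> face_chains X D" "xs = map Face c @ [Top]"
    | c where "c \<in> face_chains X D" "\<rho> (last c) < n" "xs = map Face c @ [Star, Top]"
    by blast
  then show "xs \<in> ?M"
  proof cases
    case (1 c)
    then show ?thesis
      using nonneg
      by (auto simp: maxmin_chains_def Semi_def face_chains_def sorted_wrt_append sorted_wrt_map
          plt_def[abs_def] Suc_le_eq hd_map r0 n0)
  next
    case (2 c)
    then have "\<rho> x < n" if "x \<in> set c" for x using mono[OF 2(1) that] by simp
    with 2 show ?thesis
      using nonneg
      by (auto simp: maxmin_chains_def Semi_def face_chains_def sorted_wrt_append sorted_wrt_map
          plt_def[abs_def] Suc_le_eq hd_map r0 n0)
  qed
qed

text \<open>The step from \<open>Star\<close> to \<open>Top\<close> has rank difference 1 and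
  contributes \<open>(va - vb) ^ 0\<close>; hence the second kind of chain ends in
  \<open>vb\<close>.\<close>

lemma ab_index_Semi:
  assumes D: "D \<subseteq> faces K - {T}" "{} \<in> D"
  shows "ab_index (Semi X D n) = (\<Sum>c\<in>face_chains X D. prefix_weight X c *
    ((va - vb) ^ (n - \<rho> (last c)) +
     (if \<rho> (last c) < n
      then of_int (semi_zeta X D n (Face (last c)) Star) * (va - vb) ^ (n - \<rho> (last c) - 1) * vb else 0)))"
proof -
  let ?P = "Semi X D n" and ?C = "face_chains X D"
  have fin: "finite ?C" using finite_face_chains finite_faces D(1) finite_subset by (metis finite_Diff)
  have w: "chain_weight ?P (map Face c @ t # ts) = prefix_weight X c * chain_weight ?P (Face (last c) # t # ts)"
    if "c \<in> ?C" for c t ts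
    using that by (intro chain_weight_prefix) (auto simp: Semi_def face_chains_def)
  have "ab_index ?P = (\<Sum>c\<in>?C. chain_weight ?P (map Face c @ [Top])) +
      (\<Sum>c | c \<in> ?C \<and> \<rho> (last c) < n. chain_weight ?P (map Face c @ [Star, Top]))"
  proof -
    have "(\<lambda>c. map Face c @ [Top]) ` ?C \<inter> (\<lambda>c. map Face c @ [Star, Top]) ` {c \<in> ?C. \<rho> (last c) < n} = {}"
    proof -
      have "map Face c @ [Top] \<noteq> map Face d @ [Star, Top]" for c d :: "(nat \<Rightarrow> real) set list"
      proof
        assume "map Face c @ [Top] = map Face d @ [Star, Top]"
        then have "map Face c = map Face d @ [Star]" by simp
        then have "Star \<in> set (map Face c)" by simp
        then show False by auto
      qed
      then show ?thesis by blast
    qed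
    moreover have "inj_on (\<lambda>c. map Face c @ [Top]) S" "inj_on (\<lambda>c. map Face c @ [Star, Top]) S"
      for S :: "(nat \<Rightarrow> real) set list set"
      by (auto simp: inj_on_def inj_map_eq_map inj_def)
    ultimately show ?thesis
      unfolding ab_index_def maxmin_chains_Semi[OF D]
      using fin by (subst sum.union_disjoint) (auto simp: sum.reindex)
  qed
  also have "(\<Sum>c | c \<in> ?C \<and> \<rho> (last c) < n. chain_weight ?P (map Face c @ [Star, Top])) =
      (\<Sum>c\<in>?C. if \<rho> (last c) < n then chain_weight ?P (map Face c @ [Star, Top]) else 0)"
    using fin by (rule sum.inter_filter)
  also have "(\<Sum>c\<in>?C. chain_weight ?P (map Face c @ [Top])) + \<dots> = (\<Sum>c\<in>?C. prefix_weight X c *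
    ((va - vb) ^ (n - \<rho> (last c)) +
     (if \<rho> (last c) < n
      then of_int (semi_zeta X D n (Face (last c)) Star) * (va - vb) ^ (n - \<rho> (last c) - 1) * vb else 0)))"
    unfolding sum.distrib[symmetric]
  proof (rule sum.cong[OF refl])
    fix c assume c: "c \<in> ?C"
    have "chain_weight ?P [Face (last c), Top] = (va - vb) ^ (n - \<rho> (last c))"
      by (simp add: Semi_def)
    moreover have "chain_weight ?P [Face (last c), Star, Top] =
        of_int (semi_zeta X D n (Face (last c)) Star) * (va - vb) ^ (n - \<rho> (last c) - 1) * vb"
      by (simp add: Semi_def del: semi_zeta.simps(1))
    ultimately show "chain_weight ?P (map Face c @ [Top]) +
        (if \<rho> (last c) < n then chain_weight ?P (map Face c @ [Star, Top]) else 0) =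
      prefix_weight X c * ((va - vb) ^ (n - \<rho> (last c)) +
     (if \<rho> (last c) < n
      then of_int (semi_zeta X D n (Face (last c)) Star) * (va - vb) ^ (n - \<rho> (last c) - 1) * vb else 0))"
      using w[OF c, of Top "[]"] w[OF c, of Star "[Top]"] by (simp add: distrib_left del: semi_zeta.simps(1))
  qed
  finally show ?thesis .
qed

end

section \<open>Cancellation over the faces of the coarse subdivision\<close>

locale ball_refinement = \<Gamma>: ball_CW n \<Gamma> + \<Lambda>: ball_CW n \<Lambda> for n \<Gamma> \<Lambda> +
  assumes refines: "cw_refines (closed_ball n) \<Lambda> \<Gamma>"
begin

abbreviation "X \<equiv> closed_ball n"
abbreviation "\<rho> \<equiv> face_rank (closed_ball n)"
abbreviation "T \<equiv> open_ball n"
abbreviation "sgn_face F \<equiv> (- 1) ^ (n + 1 - \<rho> F)"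

lemma open_ball_not_below:
  assumes "F \<in> faces \<Gamma>" "F \<noteq> T" shows "T \<notin> restrict_faces X \<Lambda> F"
proof
  assume "T \<in> restrict_faces X \<Lambda> F"
  then have "T \<subseteq> X closure_of F" by (simp add: restrict_faces_def)
  moreover have "X closure_of F \<subseteq> bsphere n"
    using \<Gamma>.face_subset_bsphere[OF assms] attaches_closed_ball[of n]
    by (intro closure_of_minimal) (auto simp: attaches_def)
  ultimately show False using zero_in_open_ball[of n] by (auto simp: bsphere_def)
qed

lemma sgn_face: "F \<in> faces \<Gamma> \<Longrightarrow> sgn_face F = ((- 1) ^ (n + 1) * (- 1) ^ \<rho> F :: int)"
  using \<Gamma>.rank_le_Suc[of F] by (cases "even (\<rho> F)"; cases "even n") auto

text \<open>The open ball lies above every \<open>x\<close> and has sign +1, so the remaining faces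
  of the vanishing sum contribute -1.\<close>

lemma sum_sgn_above:
  assumes x: "x \<in> faces \<Lambda>" "x \<noteq> T"
  shows "(\<Sum>F | F \<in> faces \<Gamma> \<and> F \<noteq> T \<and> x \<subseteq> X closure_of F. sgn_face F) = (- 1 :: int)"
proof -
  let ?A = "{F \<in> faces \<Gamma>. x \<subseteq> X closure_of F}"
  have "(\<Sum>F\<in>?A. sgn_face F) = (- 1) ^ (n + 1) * (\<Sum>F\<in>?A. (- 1) ^ \<rho> F :: int)"
    unfolding sum_distrib_left by (intro sum.cong refl sgn_face) simp
  then have 0: "(\<Sum>F\<in>?A. sgn_face F) = (0::int)"
    using \<Lambda>.euler_upper[OF \<Gamma>.CW refines x] by simp
  have "T \<in> ?A" using \<Gamma>.T_face \<Lambda>.face_subset_topspace[OF x(1)] by (simp add: closure_of_open_ball)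
  moreover have "?A - {T} = {F. F \<in> faces \<Gamma> \<and> F \<noteq> T \<and> x \<subseteq> X closure_of F}" by blast
  moreover have "finite ?A" using \<Gamma>.finite_faces by simp
  ultimately show ?thesis using 0 sum.remove[of ?A T "\<lambda>F. sgn_face F :: int"] \<Gamma>.rank_T by simp
qed

text \<open>After exchanging the sums, each \<open>y\<close> above \<open>x\<close> receives the
  total sign -1 from the faces above it. The separate links thereby merge into one alternating sum
  over \<Lambda>, which is known.\<close>

lemma sum_zeta_star:
  assumes x: "x \<in> faces \<Lambda>" "x \<noteq> T"
  shows "(\<Sum>F | F \<in> faces \<Gamma> \<and> F \<noteq> T \<and> x \<subseteq> X closure_of F.
    sgn_face F * semi_zeta X (restrict_faces X \<Lambda> F) n (Face x) Star) = 0"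
proof -
  let ?A = "{F. F \<in> faces \<Gamma> \<and> F \<noteq> T \<and> x \<subseteq> X closure_of F}"
  let ?Y = "{y \<in> faces \<Lambda>. y \<noteq> T \<and> face_le X x y}"
  define \<epsilon> where "\<epsilon> y = ((- 1) ^ (\<rho> y - \<rho> x + 1) :: int)" for y
  have finA: "finite ?A" and finY: "finite ?Y" using \<Gamma>.finite_faces \<Lambda>.finite_faces by auto
  have "(\<Sum>F\<in>?A. sgn_face F * link_chi X (restrict_faces X \<Lambda> F) x) =
      (\<Sum>F\<in>?A. \<Sum>y | y \<in> ?Y \<and> y \<subseteq> X closure_of F. sgn_face F * \<epsilon> y)"
  proof (rule sum.cong[OF refl])
    fix F assume F: "F \<in> ?A"
    have "{y. y \<in> restrict_faces X \<Lambda> F \<and> face_le X x y} = {y. y \<in> ?Y \<and> y \<subseteq> X closure_of F}"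
      using open_ball_not_below[of F] F by (auto simp: restrict_faces_def)
    then show "sgn_face F * link_chi X (restrict_faces X \<Lambda> F) x =
        (\<Sum>y | y \<in> ?Y \<and> y \<subseteq> X closure_of F. sgn_face F * \<epsilon> y)"
      by (simp add: link_chi_def \<epsilon>_def sum_distrib_left)
  qed
  also have "\<dots> = (\<Sum>y\<in>?Y. \<Sum>F | F \<in> ?A \<and> y \<subseteq> X closure_of F. sgn_face F * \<epsilon> y)"
    by (rule sum.swap_restrict[OF finA finY])
  also have "\<dots> = (\<Sum>y\<in>?Y. - \<epsilon> y)"
  proof (rule sum.cong[OF refl])
    fix y assume y: "y \<in> ?Y"
    \<comment> \<open>Above \<open>y\<close> the condition at \<open>x\<close> is automatic, so the
      inner sum runs over all \<open>F\<close> above \<open>y\<close> and is again -1.\<close>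
    have "x \<subseteq> X closure_of F" if "y \<subseteq> X closure_of F" for F
    proof -
      have "x \<subseteq> X closure_of y" using y \<Lambda>.face_le_iff[OF x(1)] by simp
      also have "\<dots> \<subseteq> X closure_of F" using that by (simp add: closure_of_minimal)
      finally show ?thesis .
    qed
    then have "{F. F \<in> ?A \<and> y \<subseteq> X closure_of F} = {F. F \<in> faces \<Gamma> \<and> F \<noteq> T \<and> y \<subseteq> X closure_of F}"
      by blast
    then show "(\<Sum>F | F \<in> ?A \<and> y \<subseteq> X closure_of F. sgn_face F * \<epsilon> y) = - \<epsilon> y"
      using sum_sgn_above[of y] y by (simp flip: sum_distrib_right)
  qed
  also have "\<dots> = (- 1) ^ (n - \<rho> x)"
  proof -
    let ?B = "{y. y \<in> faces \<Lambda> \<and> face_le X x y}"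
    have TB: "T \<in> ?B" using \<Lambda>.T_face \<Lambda>.face_le_T[OF x(1)] by simp
    have "?B - {T} = ?Y" by blast
    moreover have "finite ?B" using \<Lambda>.finite_faces by simp
    \<comment> \<open>The open ball contributes \<open>(-1) ^ (n + 1)\<close> to the vanishing sum
      over \<open>?B\<close>; it moves to the other side.\<close>
    ultimately have "(\<Sum>y\<in>?Y. (- 1) ^ \<rho> y) = ((- 1) ^ n :: int)"
      using sum.remove[of ?B T "\<lambda>y. (- 1) ^ \<rho> y :: int"] TB \<Lambda>.euler_interval[OF x] \<Lambda>.rank_T by simp
    moreover have "- \<epsilon> y = (- 1) ^ \<rho> x * (- 1) ^ \<rho> y" if y: "y \<in> ?Y" for y
    proof -
      have "\<rho> x \<le> \<rho> y" using face_rank_less[OF \<Lambda>.CW x(1), of y] y by (cases "x = y") auto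
      then show ?thesis unfolding \<epsilon>_def
        by (cases "even (\<rho> x)"; cases "even (\<rho> y)") auto
    qed
    ultimately have "(\<Sum>y\<in>?Y. - \<epsilon> y) = (- 1) ^ \<rho> x * (- 1) ^ n"
      by (simp flip: sum_distrib_left)
    then show ?thesis
      using \<Lambda>.rank_le[OF x] by (cases "even (\<rho> x)"; cases "even n") auto
  qed
  finally have chi: "(\<Sum>F\<in>?A. sgn_face F * link_chi X (restrict_faces X \<Lambda> F) x) = (- 1) ^ (n - \<rho> x)" .
  have "(\<Sum>F\<in>?A. sgn_face F * semi_zeta X (restrict_faces X \<Lambda> F) n (Face x) Star) =
      (\<Sum>F\<in>?A. sgn_face F) + (- 1) ^ (n - \<rho> x) * (\<Sum>F\<in>?A. sgn_face F * link_chi X (restrict_faces X \<Lambda> F) x)"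
    by (simp add: distrib_left sum.distrib sum_distrib_left mult.left_commute)
  \<comment> \<open>The summand 1 of the zeta value gives -1, the link term the square of
    \<open>(-1) ^ (n - \<rho> x)\<close>.\<close>
  then show ?thesis
    unfolding chi sum_sgn_above[OF x] by (simp flip: power_add)
qed

text \<open>All entries of a chain lie in the closure of the last one, so testing that entry
  suffices. This turns the double sum over \<open>F\<close> and its chains into one whose order can
  be exchanged.\<close>

lemma face_chains_restrict:
  assumes "F \<in> faces \<Gamma>" "F \<noteq> T"
  shows "face_chains X (restrict_faces X \<Lambda> F) =
    {c \<in> face_chains X (faces \<Lambda> - {T}). last c \<subseteq> X closure_of F}"
proof (intro equalityI subsetI)
  fix c assume c: "c \<in> face_chains X (restrict_faces X \<Lambda> F)"
  then have "last c \<in> restrict_faces X \<Lambda> F" by (auto simp: face_chains_def)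
  then show "c \<in> {c \<in> face_chains X (faces \<Lambda> - {T}). last c \<subseteq> X closure_of F}"
    using c open_ball_not_below[OF assms] by (auto simp: face_chains_def restrict_faces_def)
next
  fix c assume c: "c \<in> {c \<in> face_chains X (faces \<Lambda> - {T}). last c \<subseteq> X closure_of F}"
  have "x \<in> restrict_faces X \<Lambda> F" if x: "x \<in> set c" for x
  proof -
    have xL: "x \<in> faces \<Lambda>" using c x by (auto simp: face_chains_def)
    have "x \<subseteq> X closure_of last c"
      using face_chain_le_last[of c X _ x] c x \<Lambda>.face_le_iff[OF xL] by blast
    also have "\<dots> \<subseteq> X closure_of F" using c by (simp add: closure_of_minimal)
    finally show ?thesis using xL by (simp add: restrict_faces_def)
  qed
  then show "c \<in> face_chains X (restrict_faces X \<Lambda> F)"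
    using c by (auto simp: face_chains_def)
qed

lemma alternating_sum_semi_index:
  "(\<Sum>F\<in>faces \<Gamma>. sgn_face F * semi_index n \<Lambda> F) = 0"
proof -
  let ?C = "face_chains X (faces \<Lambda> - {T})"
  let ?G = "faces \<Gamma> - {T}"
  \<comment> \<open>The weight of everything after \<open>x\<close> in the semisuspension of
    \<open>F\<close>: a direct step to \<open>Top\<close>, or a detour through
    \<open>Star\<close>.\<close>
  define t where "t F x = (va - vb) ^ (n - \<rho> x) + (if \<rho> x < n
      then of_int (semi_zeta X (restrict_faces X \<Lambda> F) n (Face x) Star) * (va - vb) ^ (n - \<rho> x - 1) * vb else 0)"
    for F x
  have finC: "finite ?C" using finite_face_chains \<Lambda>.finite_faces by blast
  have finG: "finite ?G" using \<Gamma>.finite_faces by simp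
  have "(\<Sum>F\<in>?G. sgn_face F * semi_index n \<Lambda> F) =
      (\<Sum>F\<in>?G. \<Sum>c | c \<in> ?C \<and> last c \<subseteq> X closure_of F. prefix_weight X c * (of_int (sgn_face F) * t F (last c)))"
  proof (rule sum.cong[OF refl])
    fix F assume F: "F \<in> ?G"
    have D: "restrict_faces X \<Lambda> F \<subseteq> faces \<Lambda> - {T}" "{} \<in> restrict_faces X \<Lambda> F"
      using open_ball_not_below[of F] F by (auto simp: restrict_faces_def faces_def)
    have "semi_index n \<Lambda> F = (\<Sum>c | c \<in> ?C \<and> last c \<subseteq> X closure_of F. prefix_weight X c * t F (last c))"
      using F \<Lambda>.ab_index_Semi[OF D] face_chains_restrict[of F] by (simp add: semi_index_def t_def del: semi_zeta.simps)
    \<comment> \<open>Integers commute with the non-commuting variables, so the sign may pass the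
      prefix weight.\<close>
    moreover have "of_int k * (p * q) = p * (of_int k * q)" for k and p q :: ab_poly
      by (metis mult.assoc mult_of_int_commute)
    ultimately have "of_int (sgn_face F) * semi_index n \<Lambda> F =
        (\<Sum>c | c \<in> ?C \<and> last c \<subseteq> X closure_of F. prefix_weight X c * (of_int (sgn_face F) * t F (last c)))"
      by (simp only: sum_distrib_left)
    then show "sgn_face F * semi_index n \<Lambda> F =
        (\<Sum>c | c \<in> ?C \<and> last c \<subseteq> X closure_of F. prefix_weight X c * (of_int (sgn_face F) * t F (last c)))"
      by simp
  qed
  also have "\<dots> = (\<Sum>c\<in>?C. \<Sum>F | F \<in> ?G \<and> last c \<subseteq> X closure_of F. prefix_weight X c * (of_int (sgn_face F) * t F (last c)))"
    by (rule sum.swap_restrict[OF finG finC])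
  also have "\<dots> = (\<Sum>c\<in>?C. prefix_weight X c * - ((va - vb) ^ (n - \<rho> (last c))))"
  proof (rule sum.cong[OF refl])
    fix c assume "c \<in> ?C"
    then have "last c \<in> faces \<Lambda> - {T}" using last_in_set unfolding face_chains_def by blast
    then have x: "last c \<in> faces \<Lambda>" "last c \<noteq> T" by auto
    let ?x = "last c" and ?A = "{F. F \<in> ?G \<and> last c \<subseteq> X closure_of F}"
    let ?z = "\<lambda>F. semi_zeta X (restrict_faces X \<Lambda> F) n (Face ?x) Star"
    have A: "?A = {F. F \<in> faces \<Gamma> \<and> F \<noteq> T \<and> ?x \<subseteq> X closure_of F}" by blast
    have "(\<Sum>F\<in>?A. of_int (sgn_face F) * t F ?x) =
        of_int (\<Sum>F\<in>?A. sgn_face F) * (va - vb) ^ (n - \<rho> ?x) +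
        (if \<rho> ?x < n then of_int (\<Sum>F\<in>?A. sgn_face F * ?z F) * ((va - vb) ^ (n - \<rho> ?x - 1) * vb) else 0)"
      unfolding t_def
      by (simp add: distrib_left sum.distrib sum_distrib_right of_int_sum mult.assoc del: semi_zeta.simps)
    \<comment> \<open>The detours through \<open>Star\<close> cancel among themselves. The direct
      steps survive with coefficient -1 and are the negatives of the chains of \<Lambda>
      itself.\<close>
    also have "\<dots> = - ((va - vb) ^ (n - \<rho> ?x))"
      unfolding A sum_sgn_above[OF x] sum_zeta_star[OF x] by simp
    finally show "(\<Sum>F\<in>?A. prefix_weight X c * (of_int (sgn_face F) * t F ?x)) =
        prefix_weight X c * - ((va - vb) ^ (n - \<rho> ?x))"
      by (simp flip: sum_distrib_left)
  qed
  also have "\<dots> = - semi_index n \<Lambda> T"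
    using \<Lambda>.ab_index_face_poset by (simp add: semi_index_def sum_negf)
  finally have "(\<Sum>F\<in>?G. sgn_face F * semi_index n \<Lambda> F) = - semi_index n \<Lambda> T" .
  then show ?thesis
    using sum.remove[OF \<Gamma>.finite_faces \<Gamma>.T_face, of "\<lambda>F. sgn_face F * semi_index n \<Lambda> F"] \<Gamma>.rank_T
    by simp
qed

end

theorem theorem12p1:
  fixes n :: nat and \<Gamma> \<Lambda> :: "(nat \<Rightarrow> real) set set"
  assumes "n \<ge> 1"
    and "regular_CW (closed_ball n) \<Gamma>"
    and "regular_CW (closed_ball n) \<Lambda>"
    and "cw_refines (closed_ball n) \<Lambda> \<Gamma>"
    and "{e \<in> \<Gamma>. cell_dim (closed_ball n) e = n} = {open_ball n}"
    and "{e \<in> \<Lambda>. cell_dim (closed_ball n) e = n} = {open_ball n}"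
  shows "(\<Sum>F\<in>faces \<Gamma>. (-1) ^ (n + 1 - face_rank (closed_ball n) F) * semi_index n \<Lambda> F) = 0"
proof -
  interpret ball_refinement n \<Gamma> \<Lambda>
    using assms by unfold_locales
  show ?thesis by (rule alternating_sum_semi_index)
qed

end
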